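(* Let $X\subset\mathbb{R}^n$ be compact and let $f:\mathbb{R}^n\to\mathbb{R}^n$ be a locally Lipschitz continuous vector field. Let $\mathcal{A}$ be the global attractor for the dynamical system induced by $f$ with constraint set $X$, and assume that its basin of attraction $B_f(\mathcal{A})\subset\mathbb{R}^n$ is open. Then for any $\beta>0$, the optimal value $p_4^*$ of the linear program $$p_4^*=\inf\ \int_X w(x)\,dx+\varepsilon\,\lambda(X)$$ over all $(w,J,\varepsilon,v)\in\mathcal{C}(X)\times\mathcal{C}^1(\mathbb{R}^n)\times[0,\infty)\times\mathcal{C}^1(\mathbb{R}^n)$ satisfying, on $X$, $$w+J-v\ge 1,\qquad w\ge 0,\qquad J\ge 0,\qquad \nabla J\cdot f+J+v\le\varepsilon,\qquad \beta v-\nabla v\cdot f\ge 0,$$ satisfies $$p_4^*=\lambda(\mathcal{A}).$$ Further, for any feasible $(w,J,\varepsilon,v)$, the set $J^{-1}([0,\varepsilon])\cap M_+$ is positively invariant, and $$\mathcal{A}\subset K:=J^{-1}([0,\varepsilon])\cap v^{-1}([0,\infty))\cap X$$ with $$\lambda(K\setminus\mathcal{A})\le\int_X w(x)\,dx+\varepsilon\,\lambda(X)-p_4^*,$$ where the right-hand side (and hence $\lambda(K\setminus\mathcal{A})$) converges to zero as $(w,J,\varepsilon,v)$ gets optimal, i.e. along any sequence of feasible tuples whose costs converge to $p_4^*$.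
   Context: $\lambda$ is the Lebesgue measure on $\mathbb{R}^n$; $\mathcal{C}(X)$ is the space of continuous functions on $X$ and $\mathcal{C}^1(\mathbb{R}^n)$ the space of continuously differentiable functions on $\mathbb{R}^n$. $\varphi_t(x_0)$ denotes the solution at time $t\ge 0$ of $\dot x=f(x)$, $x(0)=x_0$; a condition on $\varphi_t(x)$ for all $t\ge0$, or as $t\to\infty$, includes that the solution exists for all $t\ge 0$. A set $S\subset\mathbb{R}^n$ is positively invariant if $\varphi_t(x)\in S$ for all $x\in S$ and $t\ge 0$. The maximum positively invariant set for $X$ is $M_+=\{x_0\in X:\varphi_t(x_0)\in X\text{ for all }t\ge 0\}$. The global attractor for $X$ is the smallest compact set $\mathcal{A}\subset X$ with $\lim_{t\to\infty}\mathrm{dist}(\varphi_t(M_+),\mathcal{A})=0$, where $\mathrm{dist}$ between sets is the Hausdorff distance. It satisfies $\mathcal{A}\subset M_+$, exists and is unique since $X$ is compact (it may be empty, which is the case if $M_+=\emptyset$). The basin of attraction of $\mathcal{A}$ is $B_f(\mathcal{A})=\{x\in\mathbb{R}^n:\lim_{t\to\infty}\mathrm{dist}(\varphi_t(x),\mathcal{A})=0\}$, with $\mathrm{dist}(x,\mathcal{A})$ the Euclidean distance from a point to $\mathcal{A}$ (and $\mathrm{dist}(x,\emptyset)=+\infty$). *)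

theory Defs
  imports "HOL-Analysis.Analysis"
begin

section \<open>Solutions and the flow\<close>

text \<open>The derivative is taken within \<open>{0..t}\<close>, hence one-sided at the end points.\<close>

definition solution_upto ::
  "(real ^ 'n \<Rightarrow> real ^ 'n) \<Rightarrow> real ^ 'n \<Rightarrow> real \<Rightarrow> (real \<Rightarrow> real ^ 'n) \<Rightarrow> bool" where
  "solution_upto f x0 t y \<longleftrightarrow>
     y 0 = x0 \<and> (\<forall>s\<in>{0..t}. (y has_vector_derivative f (y s)) (at s within {0..t}))"

definition complete_forward :: "(real ^ 'n \<Rightarrow> real ^ 'n) \<Rightarrow> real ^ 'n \<Rightarrow> bool" where
  "complete_forward f x0 \<longleftrightarrow> (\<forall>t\<ge>0. \<exists>y. solution_upto f x0 t y)"

text \<open>The value is meaningful only if a solution up to time \<open>t\<close> exists; for locally Lipschitz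
  \<open>f\<close> it is then unique. Every notion below that refers to \<open>flow\<close> for all \<open>t \<ge> 0\<close> therefore
  also requires \<^const>\<open>complete_forward\<close>, explicitly or by speaking only of points of
  the maximum positively invariant set.\<close>

definition flow :: "(real ^ 'n \<Rightarrow> real ^ 'n) \<Rightarrow> real \<Rightarrow> real ^ 'n \<Rightarrow> real ^ 'n" where
  "flow f t x0 = (THE z. \<exists>y. solution_upto f x0 t y \<and> y t = z)"

definition positively_invariant :: "(real ^ 'n \<Rightarrow> real ^ 'n) \<Rightarrow> (real ^ 'n) set \<Rightarrow> bool" where
  "positively_invariant f S \<longleftrightarrow>
     (\<forall>x\<in>S. complete_forward f x \<and> (\<forall>t\<ge>0. flow f t x \<in> S))"

definition max_pos_invariant ::
  "(real ^ 'n \<Rightarrow> real ^ 'n) \<Rightarrow> (real ^ 'n) set \<Rightarrow> (real ^ 'n) set" where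
  "max_pos_invariant f X =
     {x0 \<in> X. complete_forward f x0 \<and> (\<forall>t\<ge>0. flow f t x0 \<in> X)}"


section \<open>Distances, global attractor, basin of attraction\<close>

text \<open>The distances take values in \<^typ>\<open>ennreal\<close>, where an empty infimum is \<open>\<infinity>\<close> and an empty
  supremum is \<open>0\<close>. Hence \<open>pdist x {} = \<infinity>\<close> (unlike \<^const>\<open>infdist\<close>), \<open>hausdorff_dist {} {} = 0\<close>,
  and \<open>hausdorff_dist A {} = \<infinity>\<close> for nonempty \<open>A\<close>.\<close>

definition pdist :: "'a::metric_space \<Rightarrow> 'a set \<Rightarrow> ennreal" where
  "pdist x A = (INF a\<in>A. ennreal (dist x a))"

definition hausdorff_dist :: "'a::metric_space set \<Rightarrow> 'a set \<Rightarrow> ennreal" where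
  "hausdorff_dist A B = max (SUP a\<in>A. pdist a B) (SUP b\<in>B. pdist b A)"

definition attracts_in ::
  "(real ^ 'n \<Rightarrow> real ^ 'n) \<Rightarrow> (real ^ 'n) set \<Rightarrow> (real ^ 'n) set \<Rightarrow> bool" where
  "attracts_in f X A \<longleftrightarrow>
     compact A \<and> A \<subseteq> X \<and>
     ((\<lambda>t. hausdorff_dist (flow f t ` max_pos_invariant f X) A) \<longlongrightarrow> 0) at_top"

definition is_global_attractor ::
  "(real ^ 'n \<Rightarrow> real ^ 'n) \<Rightarrow> (real ^ 'n) set \<Rightarrow> (real ^ 'n) set \<Rightarrow> bool" where
  "is_global_attractor f X A \<longleftrightarrow>
     attracts_in f X A \<and> (\<forall>A'. attracts_in f X A' \<longrightarrow> A \<subseteq> A')"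

definition basin ::
  "(real ^ 'n \<Rightarrow> real ^ 'n) \<Rightarrow> (real ^ 'n) set \<Rightarrow> (real ^ 'n) set" where
  "basin f A =
     {x. complete_forward f x \<and> ((\<lambda>t. pdist (flow f t x) A) \<longlongrightarrow> 0) at_top}"


section \<open>The linear program\<close>

definition grad :: "('a::real_inner \<Rightarrow> real) \<Rightarrow> 'a \<Rightarrow> 'a" where
  "grad g x = (THE D. GDERIV g x :> D)"

definition C1 :: "('a::real_inner \<Rightarrow> real) \<Rightarrow> bool" where
  "C1 g \<longleftrightarrow> (\<forall>x. \<exists>D. GDERIV g x :> D) \<and> continuous_on UNIV (grad g)"

definition feasible ::
  "real \<Rightarrow> (real ^ 'n \<Rightarrow> real ^ 'n) \<Rightarrow> (real ^ 'n) set \<Rightarrow>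
   (real ^ 'n \<Rightarrow> real) \<Rightarrow> (real ^ 'n \<Rightarrow> real) \<Rightarrow> real \<Rightarrow> (real ^ 'n \<Rightarrow> real) \<Rightarrow> bool" where
  "feasible \<beta> f X w J \<epsilon> v \<longleftrightarrow>
     continuous_on X w \<and> C1 J \<and> \<epsilon> \<ge> 0 \<and> C1 v \<and>
     (\<forall>x\<in>X.
        w x + J x - v x \<ge> 1 \<and>
        w x \<ge> 0 \<and>
        J x \<ge> 0 \<and>
        grad J x \<bullet> f x + J x + v x \<le> \<epsilon> \<and>
        \<beta> * v x - grad v x \<bullet> f x \<ge> 0)"

definition cost :: "(real ^ 'n) set \<Rightarrow> (real ^ 'n \<Rightarrow> real) \<Rightarrow> real \<Rightarrow> real" where
  "cost X w \<epsilon> = (LINT x:X|lebesgue. w x) + \<epsilon> * measure lebesgue X"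

text \<open>The infimum is taken in \<^typ>\<open>real\<close>; it is a genuine infimum because the set of costs is
  nonempty and bounded below, as shown next.\<close>

definition p4_opt :: "real \<Rightarrow> (real ^ 'n \<Rightarrow> real ^ 'n) \<Rightarrow> (real ^ 'n) set \<Rightarrow> real" where
  "p4_opt \<beta> f X = Inf {cost X w \<epsilon> | w J \<epsilon> v. feasible \<beta> f X w J \<epsilon> v}"

lemma GDERIV_unique:
  assumes "GDERIV g x :> D" "GDERIV g x :> D'"
  shows "D = D'"
proof -
  have "(\<lambda>h. h \<bullet> D) = (\<lambda>h. h \<bullet> D')"
    using assms unfolding gderiv_def by (rule has_derivative_unique)
  then have "(D - D') \<bullet> D = (D - D') \<bullet> D'" by (rule fun_cong)
  then have "(D - D') \<bullet> (D - D') = 0" by (simp only: inner_diff_right)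
  then show ?thesis by simp
qed

lemma grad_eqI: "GDERIV g x :> D \<Longrightarrow> grad g x = D"
  unfolding grad_def by (blast intro: the_equality GDERIV_unique)

lemma feasible_trivial:
  fixes f :: "real ^ 'n \<Rightarrow> real ^ 'n"
  shows "feasible \<beta> f X (\<lambda>_. 1) (\<lambda>_. 0) 0 (\<lambda>_. 0)"
proof -
  have g: "grad (\<lambda>_::real ^ 'n. 0) = (\<lambda>_. 0)"
    by (rule ext) (rule grad_eqI, rule GDERIV_const)
  then have "C1 (\<lambda>_::real ^ 'n. 0)"
    unfolding C1_def using GDERIV_const by auto
  then show ?thesis unfolding feasible_def g by simp
qed

lemma costs_nonempty: "{cost X w \<epsilon> | w J \<epsilon> v. feasible \<beta> f X w J \<epsilon> v} \<noteq> {}"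
  using feasible_trivial by blast

lemma costs_bdd_below: "bdd_below {cost X w \<epsilon> | w J \<epsilon> v. feasible \<beta> f X w J \<epsilon> v}"
proof (rule bdd_belowI[of _ 0])
  fix c assume "c \<in> {cost X w \<epsilon> | w J \<epsilon> v. feasible \<beta> f X w J \<epsilon> v}"
  then obtain w J \<epsilon> v where c: "c = cost X w \<epsilon>" and F: "feasible \<beta> f X w J \<epsilon> v"
    by blast
  have "0 \<le> (LINT x:X|lebesgue. w x)"
    unfolding set_lebesgue_integral_def using F
    by (intro integral_nonneg_AE) (auto simp: feasible_def indicator_def)
  with F show "0 \<le> c" by (simp add: c cost_def feasible_def)
qed

end

theory Submission
  imports Defs
begin

text \<open>
  Along a trajectory in the maximum positively invariant set \<open>M\<close>, feasibility forces \<open>v \<ge> 0\<close>, since a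
  negative value would blow up exponentially, and then \<open>J - \<epsilon>\<close> decays like \<open>exp (- t)\<close>. As \<open>A\<close> is the
  limit of \<open>\<phi>\<^sub>t(M)\<close>, it lies in \<open>K\<close>; and \<open>w + \<epsilon> \<ge> 1\<close> on \<open>K\<close> gives \<open>\<lambda>(K) \<le> cost\<close>.

  Conversely, let \<open>V\<close> be an open neighbourhood of \<open>A\<close> of almost the same measure and \<open>g\<close> a cut-off equal
  to 1 off \<open>V\<close> and to 0 near \<open>A\<close>. The function \<open>J(x) = sup {exp (2 * t) * g (\<phi>\<^sub>t(x)) | 0 \<le> t \<le> T}\<close> is at
  least 1 off \<open>V\<close>, and satisfies \<open>\<nabla>J \<bullet> f + J \<le> 0\<close> near \<open>M\<close> once \<open>\<phi>\<^sub>t(M)\<close> is close to \<open>A\<close> for \<open>t \<ge> T\<close>.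
  Away from \<open>M\<close> every point leaves \<open>X\<close> within a uniform time, so with a cut-off \<open>g'\<close> vanishing near \<open>X\<close> the
  function \<open>v(x) = - C * sup {exp (- \<beta> * t) * g' (\<phi>\<^sub>t(x)) | 0 \<le> t \<le> T'}\<close> is as negative there as desired,
  while \<open>\<nabla>v \<bullet> f \<le> \<beta> * v\<close> on \<open>X\<close>. Both functions are only Lipschitz; averaging against a smooth kernel makes
  them continuously differentiable at an arbitrarily small cost, and \<open>w = max 0 (1 - J + v)\<close>.
\<close>

subsection \<open>Existence and uniqueness of solutions\<close>

text \<open>Gronwall's inequality: \<open>exp (- k * s) * g s\<close> has a nonpositive derivative.
  Both \<open>k\<close> and \<open>g\<close> may have either sign, so it serves distances of
  solutions, negative values of \<open>v\<close> and the decay of \<open>J - \<epsilon>\<close>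
  alike.\<close>

lemma exp_growth_bound:
  fixes g :: "real \<Rightarrow> real"
  assumes "0 \<le> t"
    and der: "\<And>s. s \<in> {0..t} \<Longrightarrow> (g has_real_derivative g' s) (at s within {0..t})"
    and le: "\<And>s. s \<in> {0..t} \<Longrightarrow> g' s \<le> k * g s"
  shows "g t \<le> exp (k * t) * g 0"
proof -
  let ?q = "\<lambda>s. exp (- k * s) * g s"
  have der': "(?q has_real_derivative exp (- k * s) * (g' s - k * g s)) (at s within {0..t})"
    if "s \<in> {0..t}" for s
    using der[OF that] by (auto intro!: derivative_eq_intros simp: algebra_simps)
  have "?q 0 \<ge> ?q t"
  proof (rule DERIV_nonpos_imp_decreasing_open[OF assms(1)])
    show "continuous_on {0..t} ?q"
      by (rule DERIV_continuous_on) (erule der')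
    show "\<exists>y. DERIV ?q s :> y \<and> y \<le> 0" if "0 < s" "s < t" for s
    proof -
      have "DERIV ?q s :> exp (- k * s) * (g' s - k * g s)"
        using der'[of s] that by (simp add: at_within_Icc_at)
      moreover have "exp (- k * s) * (g' s - k * g s) \<le> 0"
        using le[of s] that by (intro mult_nonneg_nonpos) auto
      ultimately show ?thesis by blast
    qed
  qed
  then have "exp (k * t) * (exp (- k * t) * g t) \<le> exp (k * t) * g 0"
    by (intro mult_left_mono) auto
  then show ?thesis by (simp add: mult.assoc[symmetric] exp_add[symmetric])
qed

text \<open>Gronwall is applied to the squared distance, which stays differentiable where the two
  curves meet; Cauchy-Schwarz and the Lipschitz bound give it the rate \<open>2 * L\<close>.\<close>

lemma solutions_dist_le:
  fixes F :: "'a::real_inner \<Rightarrow> 'a"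
  assumes "0 \<le> t" and lip: "L-lipschitz_on S F"
    and y: "\<And>s. s \<in> {0..t} \<Longrightarrow> (y has_vector_derivative F (y s)) (at s within {0..t})"
    and z: "\<And>s. s \<in> {0..t} \<Longrightarrow> (z has_vector_derivative F (z s)) (at s within {0..t})"
    and "\<And>s. s \<in> {0..t} \<Longrightarrow> y s \<in> S" "\<And>s. s \<in> {0..t} \<Longrightarrow> z s \<in> S"
  shows "dist (y t) (z t) \<le> exp (L * t) * dist (y 0) (z 0)"
proof -
  let ?g = "\<lambda>s. (y s - z s) \<bullet> (y s - z s)"
  have "?g t \<le> exp (2 * L * t) * ?g 0"
  proof (rule exp_growth_bound[OF assms(1)])
    fix s assume s: "s \<in> {0..t}"
    have "((\<lambda>s. y s - z s) has_vector_derivative F (y s) - F (z s)) (at s within {0..t})"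
      using y[OF s] z[OF s] by (rule has_vector_derivative_diff)
    then have "((\<lambda>s. y s - z s) has_derivative (\<lambda>h. h *\<^sub>R (F (y s) - F (z s)))) (at s within {0..t})"
      by (simp add: has_vector_derivative_def)
    from has_derivative_inner[OF this this]
    show "(?g has_real_derivative 2 * ((y s - z s) \<bullet> (F (y s) - F (z s)))) (at s within {0..t})"
      unfolding has_field_derivative_def
      by (rule has_derivative_eq_rhs) (simp add: fun_eq_iff inner_commute[of "F _ - F _"])
    have "(y s - z s) \<bullet> (F (y s) - F (z s)) \<le> norm (y s - z s) * norm (F (y s) - F (z s))"
      by (rule norm_cauchy_schwarz)
    also have "\<dots> \<le> norm (y s - z s) * (L * norm (y s - z s))"
      using lipschitz_onD[OF lip] assms(5,6) s
      by (intro mult_left_mono) (auto simp: dist_norm)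
    finally show "2 * ((y s - z s) \<bullet> (F (y s) - F (z s))) \<le> 2 * L * ?g s"
      by (simp add: dot_square_norm power2_eq_square algebra_simps)
  qed
  moreover have "exp (2 * L * t) = (exp (L * t))\<^sup>2"
    by (simp add: exp_double[symmetric] mult.assoc)
  ultimately have "(norm (y t - z t))\<^sup>2 \<le> (exp (L * t) * norm (y 0 - z 0))\<^sup>2"
    by (simp only: dot_square_norm power_mult_distrib)
  then show ?thesis
    unfolding dist_norm by (rule power2_le_imp_le) simp
qed

lemma solution_upto_antimono:
  assumes "solution_upto f x t y" "0 \<le> s" "s \<le> t"
  shows "solution_upto f x s y"
  using assms has_vector_derivative_within_subset[of y _ _ "{0..t}" "{0..s}"]
  unfolding solution_upto_def by simp

lemma solution_upto_continuous: "solution_upto f x t y \<Longrightarrow> continuous_on {0..t} y"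
  unfolding solution_upto_def
  by (auto intro: has_vector_derivative_continuous simp: continuous_on_eq_continuous_within)

text \<open>Over a bounded time interval both curves sweep out a compact set, and on it a locally
  Lipschitz field is Lipschitz with a single constant.\<close>

lemma solution_upto_unique:
  fixes f :: "real ^ 'n \<Rightarrow> real ^ 'n"
  assumes lip: "local_lipschitz (UNIV :: real set) UNIV (\<lambda>_. f)"
    and "0 \<le> t" and y: "solution_upto f x t y" and z: "solution_upto f x t z"
  shows "y t = z t"
proof -
  let ?S = "y ` {0..t} \<union> z ` {0..t}"
  have "compact ?S"
    using y z by (intro compact_Un compact_continuous_image solution_upto_continuous) auto
  moreover have "local_lipschitz {0::real} ?S (\<lambda>_. f)"
    using lip by (rule local_lipschitz_subset) auto
  ultimately obtain L where "\<And>t. t \<in> {0::real} \<Longrightarrow> L-lipschitz_on ?S f"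
    using local_lipschitz_compact_implies_lipschitz[of "{0::real}" ?S "\<lambda>_. f"] by auto
  then have L: "L-lipschitz_on ?S f" by simp
  have "dist (y t) (z t) \<le> exp (L * t) * dist (y 0) (z 0)"
    using y z unfolding solution_upto_def
    by (intro solutions_dist_le[OF assms(2) L]) auto
  then show ?thesis using y z by (simp add: solution_upto_def)
qed

lemma flow_eqI:
  fixes f :: "real ^ 'n \<Rightarrow> real ^ 'n"
  assumes "local_lipschitz (UNIV :: real set) UNIV (\<lambda>_. f)" "0 \<le> t" "solution_upto f x t y"
  shows "flow f t x = y t"
  unfolding flow_def using solution_upto_unique[OF assms(1,2)] assms(3) by blast

section \<open>Picard iteration and global existence\<close>

fun picard :: "('a::banach \<Rightarrow> 'a) \<Rightarrow> 'a \<Rightarrow> nat \<Rightarrow> real \<Rightarrow> 'a" where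
  "picard F x 0 t = x"
| "picard F x (Suc n) t = x + integral {0..t} (\<lambda>s. F (picard F x n s))"

lemma picard_continuous:
  assumes "continuous_on UNIV F"
  shows "continuous_on {0..T} (picard F x n)"
proof (induction n)
  case 0
  have "picard F x 0 = (\<lambda>_. x)" by auto
  then show ?case by simp
next
  case (Suc n)
  have "continuous_on {0..T} (\<lambda>s. F (picard F x n s))"
    by (rule continuous_on_compose2[OF assms Suc]) auto
  then have "continuous_on {0..T} (\<lambda>t. integral {0..t} (\<lambda>s. F (picard F x n s)))"
    by (intro indefinite_integral_continuous_1 integrable_continuous_real)
  then have "continuous_on {0..T} (\<lambda>t. x + integral {0..t} (\<lambda>s. F (picard F x n s)))"
    by (intro continuous_intros)
  moreover have "picard F x (Suc n) = (\<lambda>t. x + integral {0..t} (\<lambda>s. F (picard F x n s)))"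
    by auto
  ultimately show ?case by simp
qed

text \<open>The weight \<open>exp (2 * L * t)\<close> makes the Picard map contract on every time
  horizon: integrating \<open>L * exp (2 * L * s)\<close> returns at most half the weight, hence a
  factor 1/2 per step.\<close>

lemma picard_step_le:
  fixes F :: "'a::banach \<Rightarrow> 'a"
  assumes lip: "L-lipschitz_on UNIV F" and "0 < L" "0 \<le> t"
  shows "norm (picard F x (Suc n) t - picard F x n t) \<le> norm (F x) / L * exp (2 * L * t) / 2 ^ n"
  using \<open>0 \<le> t\<close>
proof (induction n arbitrary: t)
  case 0
  have "L * t \<le> exp (2 * L * t)"
    using exp_ge_add_one_self[of "2 * L * t"] \<open>0 < L\<close> 0 mult_nonneg_nonneg[of L t] by linarith
  then have "t \<le> exp (2 * L * t) / L"
    using \<open>0 < L\<close> by (simp add: pos_le_divide_eq mult.commute)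
  then have "norm (F x) * t \<le> norm (F x) * (exp (2 * L * t) / L)"
    by (rule mult_left_mono) simp
  then show ?case using 0 by (simp add: mult.commute)
next
  case (Suc n)
  let ?y = "picard F x"
  let ?B = "norm (F x) / L"
  have cont: "continuous_on {0..t} (\<lambda>s. F (?y n s))" for n
    by (rule continuous_on_compose2[OF lipschitz_on_continuous_on[OF lip] picard_continuous])
      (auto intro: lipschitz_on_continuous_on[OF lip])
  have int: "(\<lambda>s. F (?y n s)) integrable_on {0..t}" for n
    using cont by (rule integrable_continuous_real)
  have "?y (Suc (Suc n)) t - ?y (Suc n) t = integral {0..t} (\<lambda>s. F (?y (Suc n) s) - F (?y n s))"
    using int by (simp add: integral_diff del: picard.simps(2))
      (simp add: integral_diff)
  also have "norm \<dots> \<le> integral {0..t} (\<lambda>s. L * (?B * exp (2 * L * s) / 2 ^ n))"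
  proof (rule integral_norm_bound_integral)
    show "(\<lambda>s. F (?y (Suc n) s) - F (?y n s)) integrable_on {0..t}"
      using int[of "Suc n"] int[of n] by (rule integrable_diff)
    show "(\<lambda>s. L * (?B * exp (2 * L * s) / 2 ^ n)) integrable_on {0..t}"
      by (intro integrable_continuous_real continuous_intros) simp
    fix s assume s: "s \<in> {0..t}"
    have "norm (F (?y (Suc n) s) - F (?y n s)) \<le> L * norm (?y (Suc n) s - ?y n s)"
      using lipschitz_onD[OF lip] by (simp add: dist_norm del: picard.simps)
    also have "\<dots> \<le> L * (?B * exp (2 * L * s) / 2 ^ n)"
      using Suc.IH[of s] s \<open>0 < L\<close> by (intro mult_left_mono) auto
    finally show "norm (F (?y (Suc n) s) - F (?y n s)) \<le> L * (?B * exp (2 * L * s) / 2 ^ n)" .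
  qed
  also have "\<dots> = ?B / 2 ^ Suc n * exp (2 * L * t) - ?B / 2 ^ Suc n * exp (2 * L * 0)"
  proof (intro integral_unique fundamental_theorem_of_calculus Suc.prems)
    fix s assume "s \<in> {0..t}"
    have "((\<lambda>s. ?B / 2 ^ Suc n * exp (2 * L * s)) has_real_derivative
        ?B / 2 ^ Suc n * (exp (2 * L * s) * (2 * L))) (at s within {0..t})"
      by (rule DERIV_cmult) (auto intro!: derivative_eq_intros)
    moreover have "?B / 2 ^ Suc n * (exp (2 * L * s) * (2 * L)) = L * (?B * exp (2 * L * s) / 2 ^ n)"
      by simp
    ultimately show "((\<lambda>s. ?B / 2 ^ Suc n * exp (2 * L * s)) has_vector_derivative
        L * (?B * exp (2 * L * s) / 2 ^ n)) (at s within {0..t})"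
      by (simp only: has_real_derivative_iff_has_vector_derivative)
  qed
  also have "\<dots> \<le> ?B * exp (2 * L * t) / 2 ^ Suc n"
    using \<open>0 < L\<close> by simp
  finally show ?case .
qed

text \<open>On each bounded interval the Picard steps are dominated by a geometric series, so the
  iterates converge uniformly. The limit satisfies the integral equation, and the fundamental
  theorem of calculus differentiates it.\<close>

lemma lipschitz_solution_exists:
  fixes F :: "'a::banach \<Rightarrow> 'a"
  assumes lip: "L-lipschitz_on UNIV F"
  obtains y where "y 0 = x"
    "\<And>s t. s \<in> {0..t} \<Longrightarrow> (y has_vector_derivative F (y s)) (at s within {0..t})"
proof -
  \<comment> \<open>\<open>L\<close> may be 0, whereas \<open>picard_step_le\<close> divides by its
    constant.\<close>
  define K where "K = L + 1"
  have "0 < K" using lipschitz_on_nonneg[OF lip] by (simp add: K_def)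
  have lipK: "K-lipschitz_on UNIV F"
    using lip by (rule lipschitz_on_mono) (auto simp: K_def)
  note contF = lipschitz_on_continuous_on[OF lip]
  let ?y = "picard F x"
  let ?B = "norm (F x) / K"
  define y where "y t = x + (\<Sum>n. ?y (Suc n) t - ?y n t)" for t
  have sums: "x + (\<Sum>i<n. ?y (Suc i) t - ?y i t) = ?y n t" for n t
    by (subst sum_lessThan_telescope) simp
  have unif: "uniform_limit {0..T} ?y y sequentially" for T
  proof -
    have "uniform_limit {0..T} (\<lambda>n t. \<Sum>i<n. ?y (Suc i) t - ?y i t)
        (\<lambda>t. \<Sum>n. ?y (Suc n) t - ?y n t) sequentially"
    proof (rule Weierstrass_m_test)
      show "norm (?y (Suc n) t - ?y n t) \<le> ?B * exp (2 * K * T) * (1 / 2) ^ n" if "t \<in> {0..T}" for n t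
      proof -
        have "norm (?y (Suc n) t - ?y n t) \<le> ?B * exp (2 * K * t) / 2 ^ n"
          using that by (intro picard_step_le lipK \<open>0 < K\<close>) auto
        also have "\<dots> \<le> ?B * exp (2 * K * T) / 2 ^ n"
          using that \<open>0 < K\<close> by (intro divide_right_mono mult_left_mono) auto
        finally show ?thesis by (simp add: power_divide)
      qed
      show "summable (\<lambda>n. ?B * exp (2 * K * T) * (1 / 2) ^ n)"
        by (intro summable_mult summable_geometric) auto
    qed
    then have "uniform_limit {0..T} (\<lambda>n t. x + (\<Sum>i<n. ?y (Suc i) t - ?y i t))
        (\<lambda>t. x + (\<Sum>n. ?y (Suc n) t - ?y n t)) sequentially"
      by (intro uniform_limit_add uniform_limit_const)
    then show ?thesis
      unfolding sums y_def[abs_def] by simp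
  qed
  have cont: "continuous_on {0..T} y" for T
    by (rule uniform_limit_theorem[OF _ unif]) (auto intro!: always_eventually picard_continuous contF)
  have contFy: "continuous_on {0..T} (\<lambda>s. F (y s))" for T
    by (rule continuous_on_compose2[OF contF cont]) auto
  have eq: "y t = x + integral {0..t} (\<lambda>s. F (y s))" if "0 \<le> t" for t
  proof (rule LIMSEQ_unique)
    show "(\<lambda>n. ?y (Suc n) t) \<longlonglongrightarrow> y t"
      using tendsto_uniform_limitI[OF unif[of t], of t] that
      by (intro LIMSEQ_Suc) auto
    have "uniform_limit {0..t} (\<lambda>n s. F (?y n s)) (\<lambda>s. F (y s)) sequentially"
    proof (rule uniform_limitI)
      fix e :: real assume "0 < e"
      then have "\<forall>\<^sub>F n in sequentially. \<forall>s\<in>{0..t}. dist (?y n s) (y s) < e / K"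
        using \<open>0 < K\<close> by (intro uniform_limitD[OF unif]) auto
      then show "\<forall>\<^sub>F n in sequentially. \<forall>s\<in>{0..t}. dist (F (?y n s)) (F (y s)) < e"
      proof eventually_elim
        case (elim n)
        show ?case
        proof
          fix s assume "s \<in> {0..t}"
          then have "dist (?y n s) (y s) < e / K" using elim by blast
          then have "K * dist (?y n s) (y s) < e"
            using \<open>0 < K\<close> by (simp add: pos_less_divide_eq mult.commute)
          then show "dist (F (?y n s)) (F (y s)) < e"
            using lipschitz_onD[OF lipK, of "?y n s" "y s"] by simp
        qed
      qed
    qed
    moreover have "continuous_on {0..t} (\<lambda>s. F (?y n s))" for n
      by (rule continuous_on_compose2[OF contF picard_continuous[OF contF]]) auto
    ultimately obtain I J where I: "\<And>n. ((\<lambda>s. F (?y n s)) has_integral I n) {0..t}"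
      "((\<lambda>s. F (y s)) has_integral J) {0..t}" "I \<longlonglongrightarrow> J"
      by (rule uniform_limit_integral) auto
    then have "(\<lambda>n. integral {0..t} (\<lambda>s. F (?y n s))) \<longlonglongrightarrow> integral {0..t} (\<lambda>s. F (y s))"
      by (simp add: integral_unique[OF I(1)] integral_unique[OF I(2)])
    then show "(\<lambda>n. ?y (Suc n) t) \<longlonglongrightarrow> x + integral {0..t} (\<lambda>s. F (y s))"
      by (auto intro!: tendsto_intros)
  qed
  show ?thesis
  proof
    show "y 0 = x" using eq[of 0] by simp
    fix s t :: real assume s: "s \<in> {0..t}"
    have "((\<lambda>t. x + integral {0..t} (\<lambda>s. F (y s))) has_vector_derivative F (y s)) (at s within {0..t})"
      using integral_has_vector_derivative[OF contFy s] by (auto intro!: derivative_eq_intros)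
    then show "(y has_vector_derivative F (y s)) (at s within {0..t})"
      by (rule has_vector_derivative_transform[OF s, rotated]) (simp add: eq)
  qed
qed


subsection \<open>The flow of a bounded Lipschitz field\<close>

locale bounded_lipschitz_field =
  fixes F :: "real ^ 'n \<Rightarrow> real ^ 'n" and L B :: real
  assumes lip: "L-lipschitz_on UNIV F"
    and bound: "norm (F x) \<le> B"
begin

lemma L_nonneg: "0 \<le> L"
  using lip by (rule lipschitz_on_nonneg)

lemma B_nonneg: "0 \<le> B"
  using bound[of 0] norm_ge_zero by (rule order_trans[rotated])

lemma local_lipschitz_field: "local_lipschitz (UNIV :: real set) UNIV (\<lambda>_. F)"
proof (rule local_lipschitzI)
  fix t :: real and x :: "real ^ 'n"
  show "\<exists>u>0. \<exists>L. \<forall>t\<in>cball t u \<inter> UNIV. L-lipschitz_on (cball x u \<inter> UNIV) F"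
    using lipschitz_on_subset[OF lip] by (intro exI[of _ 1]) auto
qed

lemma flow_eq: "0 \<le> t \<Longrightarrow> solution_upto F x t y \<Longrightarrow> flow F t x = y t"
  using local_lipschitz_field by (rule flow_eqI)

lemma flow_solution: "solution_upto F x t (\<lambda>s. flow F s x)"
proof -
  obtain y where y: "y 0 = x"
    "\<And>s t. s \<in> {0..t} \<Longrightarrow> (y has_vector_derivative F (y s)) (at s within {0..t})"
    using lipschitz_solution_exists[OF lip] by blast
  then have sol: "solution_upto F x t y" for t
    by (simp add: solution_upto_def)
  have eq: "flow F s x = y s" if "0 \<le> s" for s
    using that sol by (rule flow_eq)
  have "((\<lambda>s. flow F s x) has_vector_derivative F (flow F s x)) (at s within {0..t})"
    if s: "s \<in> {0..t}" for s
    using y(2)[OF s] s eq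
    by (auto intro: has_vector_derivative_transform[OF s, rotated])
  moreover have "flow F 0 x = x" using eq[of 0] y(1) by simp
  ultimately show ?thesis by (simp add: solution_upto_def)
qed

lemma flow_derivative:
  "s \<in> {0..t} \<Longrightarrow> ((\<lambda>s. flow F s x) has_vector_derivative F (flow F s x)) (at s within {0..t})"
  using flow_solution unfolding solution_upto_def by blast

lemma flow_0 [simp]: "flow F 0 x = x"
  using flow_solution[of x 0] by (simp add: solution_upto_def)

lemma flow_continuous: "continuous_on {0..t} (\<lambda>s. flow F s x)"
  using flow_solution by (rule solution_upto_continuous)

lemma flow_dist_le: "0 \<le> t \<Longrightarrow> dist (flow F t x) (flow F t y) \<le> exp (L * t) * dist x y"
  using solutions_dist_le[of t L UNIV F "\<lambda>s. flow F s x" "\<lambda>s. flow F s y"] lip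
  by (simp add: flow_derivative)

text \<open>The orbit delayed by \<open>t\<close> solves the same autonomous equation from
  \<open>flow F t x\<close>, so uniqueness identifies the two.\<close>

lemma flow_add:
  assumes "0 \<le> s" "0 \<le> t"
  shows "flow F (s + t) x = flow F s (flow F t x)"
proof -
  have "((\<lambda>r. flow F (r + t) x) has_vector_derivative F (flow F (r + t) x)) (at r within {0..s})"
    if r: "r \<in> {0..s}" for r
  proof -
    have "((\<lambda>r. flow F r x) has_vector_derivative F (flow F (r + t) x))
        (at (r + t) within (\<lambda>r. r + t) ` {0..s})"
      by (rule has_vector_derivative_within_subset[OF flow_derivative[of _ "s + t"]])
        (use r assms in auto)
    moreover have "((\<lambda>r. r + t) has_vector_derivative 1) (at r within {0..s})"
      by (auto intro!: derivative_eq_intros)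
    ultimately show ?thesis
      using vector_diff_chain_within[of "\<lambda>r. r + t" 1 r "{0..s}"] by (simp add: o_def)
  qed
  then have "solution_upto F (flow F t x) s (\<lambda>r. flow F (r + t) x)"
    by (simp add: solution_upto_def)
  from flow_eq[OF assms(1) this] show ?thesis by simp
qed

lemma flow_speed:
  assumes "0 \<le> t"
  shows "dist (flow F t x) x \<le> B * t"
proof -
  have "B-lipschitz_on {0..t} (\<lambda>s. flow F s x)"
  proof (rule bounded_derivative_imp_lipschitz)
    show "((\<lambda>s. flow F s x) has_derivative (\<lambda>h. h *\<^sub>R F (flow F s x))) (at s within {0..t})"
      if "s \<in> {0..t}" for s
      using flow_derivative[OF that] by (simp add: has_vector_derivative_def)
    show "onorm (\<lambda>h. h *\<^sub>R F (flow F s x)) \<le> B" for s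
      by (intro onorm_bound B_nonneg) (simp add: mult.commute[of B] mult_left_mono bound)
  qed (auto simp: B_nonneg)
  from lipschitz_onD[OF this, of t 0] show ?thesis using assms by (simp add: dist_real_def)
qed

text \<open>The local error of one Euler step is of second order:
  \<open>flow F s x - s *\<^sub>R F x\<close> has derivative \<open>F (flow F s x) - F x\<close>, of
  norm at most \<open>L * B * h\<close> on \<open>{0..h}\<close>.\<close>

lemma flow_euler:
  assumes "0 \<le> h"
  shows "norm (x + h *\<^sub>R F x - flow F h x) \<le> L * B * h\<^sup>2"
proof -
  let ?y = "\<lambda>s. flow F s x - s *\<^sub>R F x"
  have "(L * B * h)-lipschitz_on {0..h} ?y"
  proof (rule bounded_derivative_imp_lipschitz)
    show "(?y has_derivative (\<lambda>r. r *\<^sub>R (F (flow F s x) - F x))) (at s within {0..h})"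
      if "s \<in> {0..h}" for s
      using flow_derivative[OF that, of x] unfolding has_vector_derivative_def
      by (auto intro!: derivative_eq_intros simp: algebra_simps)
    show "onorm (\<lambda>r. r *\<^sub>R (F (flow F s x) - F x)) \<le> L * B * h" if "s \<in> {0..h}" for s
    proof -
      have "norm (F (flow F s x) - F x) \<le> L * dist (flow F s x) x"
        using lipschitz_onD[OF lip] by (simp add: dist_norm)
      also have "\<dots> \<le> L * (B * s)"
        using flow_speed that by (intro mult_left_mono L_nonneg) auto
      also have "\<dots> \<le> L * (B * h)"
        using that by (intro mult_left_mono L_nonneg B_nonneg) auto
      finally have "norm (F (flow F s x) - F x) \<le> L * B * h" by (simp add: mult.assoc)
      then show ?thesis
        using L_nonneg B_nonneg assms
        by (intro onorm_bound) (simp_all add: mult.commute[of "L * B * h"] mult_left_mono)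
    qed
  qed (auto simp: L_nonneg B_nonneg assms)
  from lipschitz_onD[OF this, of h 0] assms have "norm (flow F h x - h *\<^sub>R F x - x) \<le> L * B * h * h"
    by (simp add: dist_norm)
  moreover have "norm (flow F h x - h *\<^sub>R F x - x) = norm (x + h *\<^sub>R F x - flow F h x)"
    by (subst norm_minus_commute) (simp add: algebra_simps)
  ultimately show ?thesis by (simp add: power2_eq_square mult.assoc)
qed

text \<open>For functions \<open>g\<close> vanishing at suitable times, this grows or decays exponentially along
  trajectories at rate \<open>- \<kappa>\<close>, and unlike an infinite-horizon integral it stays Lipschitz.\<close>

definition orbit_sup :: "real \<Rightarrow> (real ^ 'n \<Rightarrow> real) \<Rightarrow> real \<Rightarrow> real ^ 'n \<Rightarrow> real" where
  "orbit_sup \<kappa> g T x = (SUP t\<in>{0..T}. exp (\<kappa> * t) * g (flow F t x))"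

context
  fixes \<kappa> K T :: real and g :: "real ^ 'n \<Rightarrow> real"
  assumes lip_g: "K-lipschitz_on UNIV g" and g_nonneg: "\<And>x. 0 \<le> g x" and T: "0 \<le> T"
begin

lemma orbit_sup_ge:
  assumes "t \<in> {0..T}"
  shows "exp (\<kappa> * t) * g (flow F t x) \<le> orbit_sup \<kappa> g T x"
proof -
  have "continuous_on {0..T} (\<lambda>t. g (flow F t x))"
    by (rule continuous_on_compose2[OF lipschitz_on_continuous_on[OF lip_g] flow_continuous]) auto
  then have "continuous_on {0..T} (\<lambda>t. exp (\<kappa> * t) * g (flow F t x))"
    by (intro continuous_intros)
  then have "compact ((\<lambda>t. exp (\<kappa> * t) * g (flow F t x)) ` {0..T})"
    by (rule compact_continuous_image) simp
  then have "bdd_above ((\<lambda>t. exp (\<kappa> * t) * g (flow F t x)) ` {0..T})"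
    by (intro bounded_imp_bdd_above compact_imp_bounded)
  then show ?thesis
    unfolding orbit_sup_def by (rule cSUP_upper[OF assms])
qed

lemma orbit_sup_le:
  assumes "\<And>t. t \<in> {0..T} \<Longrightarrow> exp (\<kappa> * t) * g (flow F t x) \<le> c"
  shows "orbit_sup \<kappa> g T x \<le> c"
  unfolding orbit_sup_def using T assms by (intro cSUP_least) auto

lemma le_orbit_sup: "g x \<le> orbit_sup \<kappa> g T x"
  using orbit_sup_ge[of 0 x] T by simp

lemma orbit_sup_nonneg: "0 \<le> orbit_sup \<kappa> g T x"
  using g_nonneg le_orbit_sup by (rule order_trans)

text \<open>The functions under the supremum share this Lipschitz constant because \<open>t\<close>
  is bounded by \<open>T\<close>, and a supremum inherits a common constant. The absolute value
  covers both signs of \<open>\<kappa>\<close>.\<close>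

lemma orbit_sup_lipschitz:
  "(exp (\<bar>\<kappa>\<bar> * T) * (K * exp (L * T)))-lipschitz_on UNIV (orbit_sup \<kappa> g T)"
proof (rule lipschitz_onI)
  note K = lipschitz_on_nonneg[OF lip_g]
  then show "0 \<le> exp (\<bar>\<kappa>\<bar> * T) * (K * exp (L * T))" by simp
  have *: "orbit_sup \<kappa> g T x \<le> orbit_sup \<kappa> g T y + exp (\<bar>\<kappa>\<bar> * T) * (K * exp (L * T)) * dist x y" for x y
  proof (rule orbit_sup_le)
    fix t assume t: "t \<in> {0..T}"
    have "\<kappa> * t \<le> \<bar>\<kappa>\<bar> * T"
      using t by (intro mult_mono) auto
    then have e: "exp (\<kappa> * t) \<le> exp (\<bar>\<kappa>\<bar> * T)" by simp
    have "g (flow F t x) \<le> g (flow F t y) + K * dist (flow F t x) (flow F t y)"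
      using lipschitz_onD[OF lip_g, of "flow F t x" "flow F t y"] by (simp add: dist_real_def)
    also have "K * dist (flow F t x) (flow F t y) \<le> K * (exp (L * t) * dist x y)"
      using flow_dist_le t by (intro mult_left_mono K) auto
    also have "\<dots> \<le> K * (exp (L * T) * dist x y)"
      using t L_nonneg by (intro mult_left_mono mult_right_mono K) (auto intro: mult_left_mono)
    finally have "exp (\<kappa> * t) * g (flow F t x)
        \<le> exp (\<kappa> * t) * g (flow F t y) + exp (\<kappa> * t) * (K * (exp (L * T) * dist x y))"
      by (simp add: distrib_left[symmetric])
    also have "\<dots> \<le> orbit_sup \<kappa> g T y + exp (\<bar>\<kappa>\<bar> * T) * (K * (exp (L * T) * dist x y))"
      using t e K by (intro add_mono orbit_sup_ge mult_right_mono) auto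
    finally show "exp (\<kappa> * t) * g (flow F t x)
        \<le> orbit_sup \<kappa> g T y + exp (\<bar>\<kappa>\<bar> * T) * (K * exp (L * T)) * dist x y"
      by (simp add: mult.assoc)
  qed
  show "dist (orbit_sup \<kappa> g T x) (orbit_sup \<kappa> g T y) \<le> exp (\<bar>\<kappa>\<bar> * T) * (K * exp (L * T)) * dist x y" for x y
    using *[of x y] *[of y x] by (simp add: dist_real_def dist_commute abs_le_iff)
qed

text \<open>Advancing the start by \<open>h\<close> moves the time window to
  \<open>{h..T + h}\<close> and rescales the weight by \<open>exp (- \<kappa> * h)\<close>; the
  times gained beyond \<open>T\<close> contribute nothing, as \<open>g\<close> vanishes
  there.\<close>

lemma orbit_sup_flow_le:
  assumes "0 \<le> h" and 0: "\<And>s. T \<le> s \<Longrightarrow> s \<le> T + h \<Longrightarrow> g (flow F s x) = 0"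
  shows "orbit_sup \<kappa> g T (flow F h x) \<le> exp (- \<kappa> * h) * orbit_sup \<kappa> g T x"
proof (rule orbit_sup_le)
  fix t assume t: "t \<in> {0..T}"
  have "exp (\<kappa> * (t + h)) * g (flow F (t + h) x) \<le> orbit_sup \<kappa> g T x"
  proof (cases "t + h \<le> T")
    case True
    then show ?thesis using t assms(1) by (intro orbit_sup_ge) auto
  next
    case False
    then show ?thesis using 0[of "t + h"] t orbit_sup_nonneg by simp
  qed
  then have "exp (- \<kappa> * h) * (exp (\<kappa> * (t + h)) * g (flow F (t + h) x)) \<le> exp (- \<kappa> * h) * orbit_sup \<kappa> g T x"
    by (rule mult_left_mono) simp
  moreover have "exp (- \<kappa> * h) * exp (\<kappa> * (t + h)) = exp (\<kappa> * t)"
    by (simp add: exp_add[symmetric] algebra_simps)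
  moreover have "flow F (t + h) x = flow F t (flow F h x)"
    using t assms(1) by (simp add: flow_add)
  ultimately show "exp (\<kappa> * t) * g (flow F t (flow F h x)) \<le> exp (- \<kappa> * h) * orbit_sup \<kappa> g T x"
    by (simp only: mult.assoc[symmetric])
qed

text \<open>The counterpart at the other end of the window: advancing the start loses the times up
  to \<open>h\<close>, which is harmless if \<open>g\<close> vanishes there.\<close>

lemma orbit_sup_flow_ge:
  assumes "0 \<le> h" and 0: "\<And>s. 0 \<le> s \<Longrightarrow> s \<le> h \<Longrightarrow> g (flow F s x) = 0"
  shows "exp (- \<kappa> * h) * orbit_sup \<kappa> g T x \<le> orbit_sup \<kappa> g T (flow F h x)"
proof -
  have "orbit_sup \<kappa> g T x \<le> exp (\<kappa> * h) * orbit_sup \<kappa> g T (flow F h x)"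
  proof (rule orbit_sup_le)
    fix t assume t: "t \<in> {0..T}"
    show "exp (\<kappa> * t) * g (flow F t x) \<le> exp (\<kappa> * h) * orbit_sup \<kappa> g T (flow F h x)"
    proof (cases "t \<le> h")
      case True
      then show ?thesis using 0[of t] t orbit_sup_nonneg by simp
    next
      case False
      have "exp (\<kappa> * (t - h)) * g (flow F (t - h) (flow F h x)) \<le> orbit_sup \<kappa> g T (flow F h x)"
        using False t assms(1) by (intro orbit_sup_ge) auto
      then have "exp (\<kappa> * h) * (exp (\<kappa> * (t - h)) * g (flow F (t - h) (flow F h x)))
          \<le> exp (\<kappa> * h) * orbit_sup \<kappa> g T (flow F h x)"
        by (rule mult_left_mono) simp
      moreover have "exp (\<kappa> * h) * exp (\<kappa> * (t - h)) = exp (\<kappa> * t)"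
        by (simp add: exp_add[symmetric] algebra_simps)
      ultimately show ?thesis
        using False assms(1) by (simp add: flow_add[symmetric] mult.assoc[symmetric])
    qed
  qed
  then have "exp (- \<kappa> * h) * orbit_sup \<kappa> g T x
      \<le> exp (- \<kappa> * h) * (exp (\<kappa> * h) * orbit_sup \<kappa> g T (flow F h x))"
    by (rule mult_left_mono) simp
  then show ?thesis by (simp add: mult.assoc[symmetric] exp_add[symmetric])
qed

end

end


subsection \<open>Smoothing\<close>

text \<open>Squaring removes the kink of the positive part: at 0 the difference quotient is at most
  \<open>\<bar>h\<bar>\<close>. This is the profile of the smoothing kernel.\<close>

lemma DERIV_max_0_square: "((\<lambda>s. (max 0 s)\<^sup>2) has_real_derivative 2 * max 0 s) (at s)" for s :: real
proof (cases s "0::real" rule: linorder_cases)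
  case less
  have "((\<lambda>_. 0) has_real_derivative 0) (at s)" by simp
  then have "((\<lambda>s. (max 0 s)\<^sup>2) has_real_derivative 0) (at s)"
    by (rule has_field_derivative_transform_within_open[where S = "{..<0}"]) (use less in auto)
  then show ?thesis using less by simp
next
  case greater
  have "((\<lambda>s. s\<^sup>2) has_real_derivative 2 * s) (at s)" by (auto intro!: derivative_eq_intros)
  then have "((\<lambda>s. (max 0 s)\<^sup>2) has_real_derivative 2 * s) (at s)"
    by (rule has_field_derivative_transform_within_open[where S = "{0<..}"]) (use greater in auto)
  then show ?thesis using greater by simp
next
  case equal
  have "((\<lambda>h. (max 0 h)\<^sup>2 / h) \<longlongrightarrow> 0) (at (0::real))"
  proof (rule Lim_null_comparison)
    show "\<forall>\<^sub>F h in at (0::real). norm ((max 0 h)\<^sup>2 / h) \<le> \<bar>h\<bar>"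
      by (intro always_eventually allI) (auto simp: max_def power2_eq_square)
    show "((\<lambda>h::real. \<bar>h\<bar>) \<longlongrightarrow> 0) (at 0)"
      by (auto intro!: tendsto_eq_intros)
  qed
  then show ?thesis using equal by (simp add: DERIV_def)
qed

lemma integral_shift_superset:
  fixes q :: "'a::euclidean_space \<Rightarrow> 'b::banach"
  assumes cont: "continuous_on UNIV q" and 0: "\<And>y. y \<notin> cbox (a + x) (b + x) \<Longrightarrow> q y = 0"
    and sub: "cbox (a + x) (b + x) \<subseteq> S"
  shows "integral (cbox a b) (\<lambda>z. q (x + z)) = integral S q"
proof -
  have "q integrable_on cbox (a + x) (b + x)"
    by (rule integrable_continuous[OF continuous_on_subset[OF cont]]) simp
  then obtain I where I: "(q has_integral I) (cbox (a + x) (b + x))"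
    by (auto simp: integrable_on_def)
  then have "((q \<circ> (+) x) has_integral I) (cbox a b)"
    by (simp add: has_integral_shift_cbox_iff)
  moreover have "(q has_integral I) S"
    using I 0 sub by (rule has_integral_on_superset)
  ultimately show ?thesis by (simp add: o_def integral_unique)
qed

text \<open>Since \<open>u\<close> is merely continuous, the substitution \<open>y = x + z\<close>
  transfers \<open>x\<close> to the kernel \<open>\<rho> (y - x)\<close>, which Leibniz's rule can
  differentiate; the chain rule produces the minus sign.\<close>

lemma C1_convolution:
  fixes \<rho> u :: "real ^ 'n \<Rightarrow> real" and G :: "real ^ 'n \<Rightarrow> real ^ 'n"
  assumes \<rho>: "\<And>z. GDERIV \<rho> z :> G z" and G: "continuous_on UNIV G" and u: "continuous_on UNIV u"
    and supp: "\<And>z. z \<notin> cbox a b \<Longrightarrow> \<rho> z = 0 \<and> G z = 0"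
  shows "C1 (\<lambda>x. integral (cbox a b) (\<lambda>z. \<rho> z * u (x + z)))"
proof -
  let ?U = "\<lambda>x. integral (cbox a b) (\<lambda>z. \<rho> z * u (x + z))"
  let ?D = "\<lambda>x. integral (cbox a b) (\<lambda>z. (- u (x + z)) *\<^sub>R G z)"
  have cont_\<rho>: "continuous_on UNIV \<rho>"
    using \<rho> unfolding gderiv_def by (meson has_derivative_continuous_on)
  have *: "GDERIV ?U x0 :> ?D x0" for x0
  proof -
    \<comment> \<open>Leibniz's rule asks for a domain independent of \<open>x\<close>: one box has
      to contain the translated supports for all \<open>x\<close> in the unit ball around
      \<open>x0\<close>.\<close>
    have "bounded (\<Union>x\<in>ball x0 1. cbox (a + x) (b + x))"
    proof -
      have "(\<Union>x\<in>ball x0 1. cbox (a + x) (b + x)) \<subseteq> (\<lambda>(z, x). z + x) ` (cbox a b \<times> cball x0 1)"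
      proof safe
        fix x y assume "x \<in> ball x0 1" "y \<in> cbox (a + x) (b + x)"
        then have "(y - x, x) \<in> cbox a b \<times> cball x0 1"
          by (auto simp: mem_box algebra_simps)
        then show "y \<in> (\<lambda>(z, x). z + x) ` (cbox a b \<times> cball x0 1)"
          by (rule rev_image_eqI) simp
      qed
      moreover have "compact ((\<lambda>(z, x). z + x) ` (cbox a b \<times> cball x0 1))"
        by (intro compact_continuous_image compact_Times) (auto intro!: continuous_intros simp: split_beta)
      ultimately show ?thesis by (meson bounded_subset compact_imp_bounded)
    qed
    then obtain p q where pq: "\<And>x. x \<in> ball x0 1 \<Longrightarrow> cbox (a + x) (b + x) \<subseteq> cbox p q"
      using bounded_subset_cbox_symmetric[of "\<Union>x\<in>ball x0 1. cbox (a + x) (b + x)"] by (metis UN_subset_iff)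
    have 0: "\<rho> (y - x) = 0 \<and> G (y - x) = 0" if "y \<notin> cbox (a + x) (b + x)" for x y
      using that by (intro supp) (auto simp: mem_box algebra_simps)
    note cont = continuous_on_compose2[OF cont_\<rho>] continuous_on_compose2[OF G] continuous_on_compose2[OF u]
    have U_eq: "?U x = integral (cbox p q) (\<lambda>y. \<rho> (y - x) * u y)" if "x \<in> ball x0 1" for x
      using integral_shift_superset[of "\<lambda>y. \<rho> (y - x) * u y" a x b "cbox p q"] 0 pq[OF that]
      by (force intro!: continuous_intros cont)
    have D_eq: "?D x0 = integral (cbox p q) (\<lambda>y. (- u y) *\<^sub>R G (y - x0))"
      using integral_shift_superset[of "\<lambda>y. (- u y) *\<^sub>R G (y - x0)" a x0 b "cbox p q"] 0 pq[of x0]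
      by (force intro!: continuous_intros cont)
    \<comment> \<open>The derivative is packaged as a bounded linear function, the form in which
      \<open>leibniz_rule\<close> integrates it.\<close>
    let ?f' = "\<lambda>x y. blinfun_inner_left ((- u y) *\<^sub>R G (y - x))"
    have "((\<lambda>x. integral (cbox p q) (\<lambda>y. \<rho> (y - x) * u y)) has_derivative
        integral (cbox p q) (?f' x0)) (at x0 within ball x0 1)"
    proof (rule leibniz_rule)
      show "((\<lambda>x. \<rho> (y - x) * u y) has_derivative blinfun_apply (?f' x y)) (at x within ball x0 1)" for x y
      proof -
        have "(\<rho> has_derivative (\<lambda>h. h \<bullet> G (y - x))) (at (y - x))"
          using \<rho> by (simp add: gderiv_def)
        moreover have "((\<lambda>x. y - x) has_derivative (\<lambda>h. - h)) (at x within ball x0 1)"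
          by (auto intro!: derivative_eq_intros)
        ultimately have "((\<lambda>x. \<rho> (y - x)) has_derivative (\<lambda>h. - h \<bullet> G (y - x))) (at x within ball x0 1)"
          by (rule has_derivative_compose[rotated])
        then have "((\<lambda>x. \<rho> (y - x) * u y) has_derivative (\<lambda>h. (- h \<bullet> G (y - x)) * u y)) (at x within ball x0 1)"
          by (rule has_derivative_mult_left)
        then show ?thesis
          by (rule has_derivative_eq_rhs) (auto simp: fun_eq_iff)
      qed
      show "(\<lambda>y. \<rho> (y - x) * u y) integrable_on cbox p q" for x
        by (intro integrable_continuous continuous_intros cont) auto
      show "continuous_on (ball x0 1 \<times> cbox p q) (\<lambda>(x, y). ?f' x y)"
        unfolding split_beta
        by (intro bounded_linear.continuous_on[OF bounded_linear_blinfun_inner_left] continuous_intros cont) auto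
    qed auto
    also have "integral (cbox p q) (?f' x0) = blinfun_inner_left (?D x0)"
    proof -
      have "(\<lambda>y. (- u y) *\<^sub>R G (y - x0)) integrable_on cbox p q"
        by (intro integrable_continuous continuous_intros cont) auto
      from integral_linear[OF this bounded_linear_blinfun_inner_left] show ?thesis
        by (simp only: o_def D_eq)
    qed
    finally have "((\<lambda>x. integral (cbox p q) (\<lambda>y. \<rho> (y - x) * u y)) has_derivative (\<lambda>h. h \<bullet> ?D x0)) (at x0)"
      by (simp add: at_within_open[of x0 "ball x0 1"] blinfun_inner_left.rep_eq[abs_def])
    then have "(?U has_derivative (\<lambda>h. h \<bullet> ?D x0)) (at x0)"
      by (rule has_derivative_transform_within_open[of _ _ _ UNIV "ball x0 1"]) (auto simp: U_eq)
    then show ?thesis by (simp add: gderiv_def)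
  qed
  have "continuous_on UNIV ?D"
  proof (rule integral_continuous_on_param)
    show "continuous_on (UNIV \<times> cbox a b) (\<lambda>(x, z). (- u (x + z)) *\<^sub>R G z)"
      unfolding split_beta
      by (intro continuous_intros continuous_on_compose2[OF G] continuous_on_compose2[OF u]) auto
  qed
  moreover have "grad ?U = ?D"
    using grad_eqI[OF *] by (rule ext)
  ultimately show ?thesis
    unfolding C1_def using * by auto
qed

text \<open>Only one continuous derivative is asked of the kernel, so the square of the positive
  part of \<open>\<eta>\<^sup>2 - z \<bullet> z\<close>, divided by its integral, serves as the
  bump.\<close>

lemma smooth_kernel:
  assumes "0 < \<eta>"
  obtains \<rho> :: "real ^ 'n \<Rightarrow> real" and G a b where
    "\<And>z. GDERIV \<rho> z :> G z" "continuous_on UNIV G"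
    "\<And>z. 0 \<le> \<rho> z" "\<And>z. \<eta> \<le> norm z \<Longrightarrow> \<rho> z = 0"
    "\<And>z. z \<notin> cbox a b \<Longrightarrow> \<rho> z = 0 \<and> G z = 0" "integral (cbox a b) \<rho> = 1"
proof -
  define q :: "real ^ 'n \<Rightarrow> real" where "q z = (max 0 (\<eta>\<^sup>2 - z \<bullet> z))\<^sup>2" for z
  define H :: "real ^ 'n \<Rightarrow> real ^ 'n" where "H z = (2 * max 0 (\<eta>\<^sup>2 - z \<bullet> z)) *\<^sub>R ((- 2) *\<^sub>R z)" for z
  obtain a where a: "cball 0 \<eta> \<subseteq> cbox (- a) (a :: real ^ 'n)"
    using bounded_subset_cbox_symmetric[of "cball 0 \<eta>"] by blast
  define I where "I = integral (cbox (- a) a) q"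
  have H: "GDERIV q z :> H z" for z
    unfolding q_def H_def
  proof (rule GDERIV_DERIV_compose[OF _ DERIV_max_0_square])
    show "GDERIV (\<lambda>z. \<eta>\<^sup>2 - z \<bullet> z) z :> (- 2) *\<^sub>R z"
      unfolding gderiv_def by (auto intro!: derivative_eq_intros simp: inner_commute)
  qed
  have cont_q: "continuous_on S q" for S unfolding q_def by (intro continuous_intros)
  have contH: "continuous_on S H" for S unfolding H_def by (intro continuous_intros)
  have out: "q z = 0 \<and> H z = 0" if "\<eta> \<le> norm z" for z
  proof -
    have "\<eta>\<^sup>2 \<le> z \<bullet> z"
      using that assms unfolding dot_square_norm by (intro power_mono) auto
    then show ?thesis by (simp add: q_def H_def)
  qed
  have q_nonneg: "0 \<le> q z" for z by (simp add: q_def)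
  have "0 < I"
  proof -
    have "0 \<le> I" unfolding I_def
      by (intro integral_nonneg integrable_continuous cont_q q_nonneg)
    \<comment> \<open>A continuous nonnegative function with integral 0 vanishes on the box, yet
      \<open>q 0\<close> is positive.\<close>
    moreover have "I \<noteq> 0"
    proof
      assume "I = 0"
      have "(q has_integral I) (cbox (- a) a)"
        unfolding I_def by (intro integrable_integral integrable_continuous cont_q)
      then have "(q has_integral 0) (cbox (- a) a)" using \<open>I = 0\<close> by simp
      moreover have "ball 0 \<eta> \<subseteq> interior (cbox (- a) a)"
        using a by (intro interior_maximal open_ball) (meson ball_subset_cball order_trans)
      then have "0 \<in> box (- a) a" using assms by (auto simp: interior_cbox)
      ultimately have "q 0 = 0"
        using has_integral_0_cbox_imp_0[OF cont_q q_nonneg] box_subset_cbox by blast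
      then show False using assms by (simp add: q_def)
    qed
    ultimately show ?thesis by simp
  qed
  show ?thesis
  proof (rule that[of "\<lambda>z. q z / I" "\<lambda>z. H z /\<^sub>R I" "- a" a])
    show "GDERIV (\<lambda>z. q z / I) z :> H z /\<^sub>R I" for z
      using H[of z] \<open>0 < I\<close> unfolding gderiv_def
      by (auto intro!: derivative_eq_intros simp: divide_inverse)
    show "continuous_on UNIV (\<lambda>z. H z /\<^sub>R I)" by (intro continuous_intros contH)
    show "0 \<le> q z / I" for z using q_nonneg \<open>0 < I\<close> by simp
    show "q z / I = 0" if "\<eta> \<le> norm z" for z using out[OF that] by simp
    show "q z / I = 0 \<and> H z /\<^sub>R I = 0" if "z \<notin> cbox (- a) a" for z
    proof -
      have "z \<notin> cball 0 \<eta>" using that a by blast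
      then show ?thesis using out[of z] by simp
    qed
    show "integral (cbox (- a) a) (\<lambda>z. q z / I) = 1"
      using \<open>0 < I\<close> by (simp add: I_def[symmetric])
  qed
qed

context bounded_lipschitz_field
begin

text \<open>The growth condition on \<open>u\<close> is linear in \<open>u\<close>, so it survives averaging; the error
  \<open>K * L * \<eta>\<close> comes from freezing \<open>F\<close> at the centre of the averaging ball. This avoids differentiating \<open>u\<close>.\<close>

lemma smooth_approximation:
  fixes u :: "real ^ 'n \<Rightarrow> real"
  assumes u: "K-lipschitz_on UNIV u" and "0 < \<eta>"
  obtains U where "C1 U" "\<And>x. \<bar>U x - u x\<bar> \<le> K * \<eta>"
    "\<And>x k d h0. 0 < h0 \<Longrightarrow>
      (\<And>y h. dist x y < \<eta> \<Longrightarrow> 0 < h \<Longrightarrow> h < h0 \<Longrightarrow> u (flow F h y) \<le> u y + h * (k * u y + d)) \<Longrightarrow>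
      grad U x \<bullet> F x \<le> k * U x + d + K * L * \<eta>"
proof -
  obtain \<rho> :: "real ^ 'n \<Rightarrow> real" and G a b where
    \<rho>: "\<And>z. GDERIV \<rho> z :> G z" "continuous_on UNIV G"
    "\<And>z. 0 \<le> \<rho> z" "\<And>z. \<eta> \<le> norm z \<Longrightarrow> \<rho> z = 0"
    "\<And>z. z \<notin> cbox a b \<Longrightarrow> \<rho> z = 0 \<and> G z = 0" "integral (cbox a b) \<rho> = 1"
    by (rule smooth_kernel[OF \<open>0 < \<eta>\<close>]) blast
  note K = lipschitz_on_nonneg[OF u]
  note cont_u = lipschitz_on_continuous_on[OF u]
  have cont_\<rho>: "continuous_on S \<rho>" for S
    using \<rho>(1) unfolding gderiv_def by (meson has_derivative_continuous_on continuous_on_subset top_greatest)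
  define U where "U x = integral (cbox a b) (\<lambda>z. \<rho> z * u (x + z))" for x
  have int: "(\<lambda>z. \<rho> z * u (x + z)) integrable_on cbox a b" for x
    by (intro integrable_continuous continuous_intros cont_\<rho> continuous_on_compose2[OF cont_u]) auto
  have "(\<rho> has_integral 1) (cbox a b)"
    using integrable_integral[OF integrable_continuous[OF cont_\<rho>], of a b] \<rho>(6) by simp
  from has_integral_mult_left[OF this] have int_\<rho>: "((\<lambda>z. \<rho> z * c) has_integral c) (cbox a b)" for c
    by simp
  \<comment> \<open>The kernel vanishes outside the \<open>\<eta>\<close>-ball, which reduces every
    comparison of integrands to \<open>norm z < \<eta>\<close>.\<close>
  have le: "\<rho> z * s \<le> \<rho> z * t" if "norm z < \<eta> \<Longrightarrow> s \<le> t" for z s t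
    using that \<rho>(3)[of z] \<rho>(4)[of z] by (cases "norm z < \<eta>") (auto intro: mult_left_mono)
  show ?thesis
  proof (rule that[of U])
    show C1: "C1 U"
      unfolding U_def[abs_def] using \<rho>(1,2) cont_u \<rho>(5) by (rule C1_convolution)
    show "\<bar>U x - u x\<bar> \<le> K * \<eta>" for x
    proof -
      have near: "\<bar>u (x + z) - u x\<bar> \<le> K * \<eta>" if "norm z < \<eta>" for z
      proof -
        have "\<bar>u (x + z) - u x\<bar> \<le> K * norm z"
          using lipschitz_onD[OF u, of "x + z" x] by (simp add: dist_norm)
        also have "\<dots> \<le> K * \<eta>" using that K by (intro mult_left_mono) auto
        finally show ?thesis .
      qed
      have "U x \<le> u x + K * \<eta>"
        unfolding U_def
        by (rule has_integral_le[OF integrable_integral[OF int] int_\<rho>]) (rule le, drule near, simp)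
      moreover have "u x - K * \<eta> \<le> U x"
        unfolding U_def
        by (rule has_integral_le[OF int_\<rho> integrable_integral[OF int]]) (rule le, drule near, simp)
      ultimately show ?thesis by (simp add: abs_le_iff)
    qed
    fix x k d and h0 :: real
    assume "0 < h0"
      and flow: "\<And>y h. dist x y < \<eta> \<Longrightarrow> 0 < h \<Longrightarrow> h < h0 \<Longrightarrow> u (flow F h y) \<le> u y + h * (k * u y + d)"
    \<comment> \<open>The quotient is taken along the segment \<open>x + h *\<^sub>R F x\<close>, so
      its limit is \<open>grad U x \<bullet> F x\<close>; the flow enters through the hypothesis on
      \<open>u\<close>, and the Euler error \<open>K * L * B * h\<close> disappears in the
      limit.\<close>
    have quotient: "(U (x + h *\<^sub>R F x) - U x) / h \<le> k * U x + d + K * L * \<eta> + K * L * B * h"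
      if h: "0 < h" "h < h0" for h
    proof -
      let ?c = "h * (d + K * L * \<eta> + K * L * B * h)"
      \<comment> \<open>The translated segment leaves the orbit of \<open>x + z\<close> for two
        reasons: freezing the field at \<open>x\<close> costs \<open>h * (L * \<eta>)\<close> and
        the Euler step \<open>L * B * h\<^sup>2\<close>. The factor \<open>K\<close> turns both into
        errors of \<open>u\<close>.\<close>
      have pointwise: "u (x + h *\<^sub>R F x + z) \<le> (1 + h * k) * u (x + z) + ?c" if z: "norm z < \<eta>" for z
      proof -
        let ?y = "x + z"
        have "norm (h *\<^sub>R F x - h *\<^sub>R F ?y) = h * norm (F x - F ?y)"
          using h by (simp add: scaleR_diff_right[symmetric])
        also have "\<dots> \<le> h * (L * norm z)"
          using lipschitz_onD[OF lip, of x ?y] h by (intro mult_left_mono) (auto simp: dist_norm)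
        also have "\<dots> \<le> h * (L * \<eta>)"
          using z h L_nonneg by (intro mult_left_mono) auto
        finally have 1: "norm (h *\<^sub>R F x - h *\<^sub>R F ?y) \<le> h * (L * \<eta>)" .
        have 2: "norm (?y + h *\<^sub>R F ?y - flow F h ?y) \<le> L * B * h\<^sup>2"
          using h by (intro flow_euler) auto
        have "x + h *\<^sub>R F x + z - flow F h ?y
            = (h *\<^sub>R F x - h *\<^sub>R F ?y) + (?y + h *\<^sub>R F ?y - flow F h ?y)"
          by simp
        then have "norm (x + h *\<^sub>R F x + z - flow F h ?y) \<le> h * (L * \<eta>) + L * B * h\<^sup>2"
          using norm_triangle_mono[OF 1 2] by (simp only:)
        then have "K * norm (x + h *\<^sub>R F x + z - flow F h ?y) \<le> K * (h * (L * \<eta>) + L * B * h\<^sup>2)"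
          using K by (rule mult_left_mono)
        moreover have "u (x + h *\<^sub>R F x + z) \<le> u (flow F h ?y) + K * norm (x + h *\<^sub>R F x + z - flow F h ?y)"
          using lipschitz_onD[OF u, of "x + h *\<^sub>R F x + z" "flow F h ?y"] by (simp add: dist_norm)
        moreover have "u (flow F h ?y) \<le> u ?y + h * (k * u ?y + d)"
          using z h by (intro flow) (auto simp: dist_norm)
        ultimately show ?thesis by (simp add: algebra_simps power2_eq_square)
      qed
      have "((\<lambda>z. (1 + h * k) * (\<rho> z * u (x + z)) + \<rho> z * ?c) has_integral (1 + h * k) * U x + ?c) (cbox a b)"
        unfolding U_def by (intro has_integral_add has_integral_mult_right integrable_integral int int_\<rho>)
      then have "U (x + h *\<^sub>R F x) \<le> (1 + h * k) * U x + ?c"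
        unfolding U_def[of "x + h *\<^sub>R F x"]
      proof (rule has_integral_le[OF integrable_integral[OF int]])
        fix z assume "z \<in> cbox a b"
        have "\<rho> z * u (x + h *\<^sub>R F x + z) \<le> \<rho> z * ((1 + h * k) * u (x + z) + ?c)"
          by (rule le) (rule pointwise)
        then show "\<rho> z * u (x + h *\<^sub>R F x + z) \<le> (1 + h * k) * (\<rho> z * u (x + z)) + \<rho> z * ?c"
          by (simp only: distrib_left mult.left_commute)
      qed
      then have "U (x + h *\<^sub>R F x) - U x \<le> (k * U x + d + K * L * \<eta> + K * L * B * h) * h"
        by (simp add: algebra_simps)
      then show ?thesis using h by (simp add: pos_divide_le_eq)
    qed
    from C1 obtain D where D: "GDERIV U x :> D" by (auto simp: C1_def)
    have "((\<lambda>h. x + h *\<^sub>R F x) has_derivative (\<lambda>h. h *\<^sub>R F x)) (at 0)"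
      by (auto intro!: derivative_eq_intros)
    then have "((\<lambda>h. U (x + h *\<^sub>R F x)) has_derivative (\<lambda>h. (h *\<^sub>R F x) \<bullet> D)) (at 0)"
      by (rule has_derivative_compose) (use D in \<open>simp add: gderiv_def\<close>)
    then have "((\<lambda>h. U (x + h *\<^sub>R F x)) has_real_derivative F x \<bullet> D) (at 0)"
      by (simp add: has_field_derivative_def mult_commute_abs)
    then have lim: "((\<lambda>h. (U (x + h *\<^sub>R F x) - U x) / h) \<longlongrightarrow> F x \<bullet> D) (at_right 0)"
      by (auto simp: DERIV_def intro: tendsto_within_subset)
    have "((\<lambda>h. k * U x + d + K * L * \<eta> + K * L * B * h) \<longlongrightarrow> k * U x + d + K * L * \<eta> + K * L * B * 0) (at_right 0)"
      by (intro tendsto_intros)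
    then have "F x \<bullet> D \<le> k * U x + d + K * L * \<eta> + K * L * B * 0"
    proof (rule tendsto_le[OF trivial_limit_at_right_real _ lim])
      have "\<forall>\<^sub>F h in at_right 0. h \<in> {0<..<h0}"
        using \<open>0 < h0\<close> by (rule eventually_at_right_real)
      then show "\<forall>\<^sub>F h in at_right 0. (U (x + h *\<^sub>R F x) - U x) / h \<le> k * U x + d + K * L * \<eta> + K * L * B * h"
        by eventually_elim (use quotient in auto)
    qed
    then show "grad U x \<bullet> F x \<le> k * U x + d + K * L * \<eta>"
      using grad_eqI[OF D] by (simp add: inner_commute)
  qed
qed

end


subsection \<open>Reduction to a globally Lipschitz field\<close>

text \<open>\<open>f\<close> is composed with the nearest-point projection onto a ball containing
  \<open>X\<close>. Convexity makes the projection 1-Lipschitz, and compactness of the ball makes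
  \<open>f\<close> Lipschitz and bounded on it.\<close>

lemma bounded_lipschitz_extension:
  fixes f :: "real ^ 'n \<Rightarrow> real ^ 'n"
  assumes "compact X" and lip: "local_lipschitz (UNIV :: real set) UNIV (\<lambda>_. f)"
  obtains F L B where "bounded_lipschitz_field F L B" "\<And>x. x \<in> X \<Longrightarrow> F x = f x"
proof -
  obtain R where "0 < R" "X \<subseteq> ball 0 R"
    using bounded_subset_ballD[OF compact_imp_bounded[OF assms(1)]] by blast
  then have R: "X \<subseteq> cball 0 R" "0 < R"
    using ball_subset_cball by blast+
  let ?S = "cball (0 :: real ^ 'n) R"
  let ?p = "closest_point ?S"
  have S: "convex ?S" "closed ?S" "?S \<noteq> {}" using R by auto
  have "local_lipschitz {0::real} ?S (\<lambda>_. f)"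
    using lip by (rule local_lipschitz_subset) auto
  then obtain L where "\<And>t. t \<in> {0::real} \<Longrightarrow> L-lipschitz_on ?S f"
    using local_lipschitz_compact_implies_lipschitz[of "{0::real}" ?S "\<lambda>_. f"] by auto
  then have L: "L-lipschitz_on ?S f" by simp
  have p: "?p x \<in> ?S" for x using S by (intro closest_point_in_set) auto
  have "compact (f ` ?S)"
    using lipschitz_on_continuous_on[OF L] by (rule compact_continuous_image) simp
  then obtain B where B: "\<And>x. x \<in> ?S \<Longrightarrow> norm (f x) \<le> B"
    using compact_imp_bounded[of "f ` ?S"] unfolding bounded_iff by blast
  show ?thesis
  proof
    have "1-lipschitz_on UNIV ?p"
      using closest_point_lipschitz[OF S] by (intro lipschitz_onI) auto
    moreover have "L-lipschitz_on (?p ` UNIV) f"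
      using L by (rule lipschitz_on_subset) (use p in auto)
    ultimately have "(L * 1)-lipschitz_on UNIV (\<lambda>x. f (?p x))"
      by (rule lipschitz_on_compose2)
    then show "bounded_lipschitz_field (\<lambda>x. f (?p x)) L B"
      using B p by unfold_locales auto
    show "f (?p x) = f x" if "x \<in> X" for x
      using that R closest_point_self[of x ?S] by auto
  qed
qed

section \<open>Limits, Hausdorff convergence and differentiable functions\<close>

lemma hausdorff_dist_tendsto_0D:
  assumes "((\<lambda>t. hausdorff_dist (S t) A) \<longlongrightarrow> 0) G" and "0 < r"
  shows "\<forall>\<^sub>F t in G. (\<forall>x\<in>S t. \<exists>a\<in>A. dist x a < r) \<and> (\<forall>a\<in>A. \<exists>x\<in>S t. dist a x < r)"
proof -
  have "\<forall>\<^sub>F t in G. hausdorff_dist (S t) A < ennreal r"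
    using assms by (intro order_tendstoD) auto
  then show ?thesis
  proof eventually_elim
    case (elim t)
    have "pdist x A < ennreal r" if "x \<in> S t" for x
      using elim SUP_upper[OF that, of "\<lambda>x. pdist x A"] by (auto simp: hausdorff_dist_def)
    moreover have "pdist a (S t) < ennreal r" if "a \<in> A" for a
      using elim SUP_upper[OF that, of "\<lambda>a. pdist a (S t)"] by (auto simp: hausdorff_dist_def)
    ultimately show ?case
      using assms(2) by (auto simp: pdist_def INF_less_iff ennreal_less_iff)
  qed
qed

text \<open>The same \<open>r\<close> controls the distance and the slack, so a bound that holds
  only in the limit along points approaching \<open>a\<close> passes to \<open>a\<close>.\<close>

lemma le_at_limit_point:
  fixes h :: "'a::metric_space \<Rightarrow> real"
  assumes "continuous_on UNIV h" and near: "\<And>r. 0 < r \<Longrightarrow> \<exists>y. dist y a < r \<and> h y \<le> c + r"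
  shows "h a \<le> c"
proof (rule ccontr)
  assume "\<not> h a \<le> c"
  define e where "e = (h a - c) / 2"
  have "0 < e" using \<open>\<not> h a \<le> c\<close> by (simp add: e_def)
  then obtain d where d: "0 < d" "\<And>y. dist y a < d \<Longrightarrow> dist (h y) (h a) < e"
    using assms(1) unfolding continuous_on_iff by (metis UNIV_I)
  obtain y where "dist y a < min d e" "h y \<le> c + min d e"
    using near[of "min d e"] d(1) \<open>0 < e\<close> by auto
  then have "\<bar>h y - h a\<bar> < e" "h y \<le> c + e"
    using d(2)[of y] by (auto simp: dist_real_def)
  moreover have "c + e = h a - e" by (simp add: e_def field_simps)
  ultimately show False by linarith
qed

lemma C1_GDERIV: "C1 g \<Longrightarrow> GDERIV g x :> grad g x"
  unfolding C1_def using grad_eqI by metis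

lemma C1_continuous_on: "C1 g \<Longrightarrow> continuous_on S g"
  using C1_GDERIV unfolding gderiv_def
  by (meson has_derivative_continuous_on continuous_on_subset top_greatest)

lemma C1_add_const:
  assumes "C1 g"
  shows "C1 (\<lambda>x. g x + c)" "grad (\<lambda>x. g x + c) = grad g"
proof -
  have *: "GDERIV (\<lambda>x. g x + c) x :> grad g x" for x
    using GDERIV_add[OF C1_GDERIV[OF assms] GDERIV_const] by simp
  then show eq: "grad (\<lambda>x. g x + c) = grad g"
    by (intro ext grad_eqI)
  show "C1 (\<lambda>x. g x + c)"
    using * assms unfolding C1_def eq by blast
qed

section \<open>Costs compared with Lebesgue measures\<close>

lemma set_integrable_continuous_compact:
  fixes w :: "'a::euclidean_space \<Rightarrow> real"
  assumes "compact X" "continuous_on X w"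
  shows "set_integrable lebesgue X w"
proof -
  have *: "integrable lborel (\<lambda>x. indicator X x *\<^sub>R w x)"
    using assms by (intro borel_integrable_compact)
  then show ?thesis
    unfolding set_integrable_def
    by (subst integrable_completion) (rule borel_measurable_integrable[OF *], rule *)
qed

lemma measure_le_cost:
  fixes w :: "real ^ 'n \<Rightarrow> real"
  assumes "compact X" "continuous_on X w" and K: "K \<in> lmeasurable" "K \<subseteq> X"
    and "\<And>x. x \<in> X \<Longrightarrow> 0 \<le> w x" "0 \<le> \<epsilon>" "\<And>x. x \<in> K \<Longrightarrow> 1 \<le> w x + \<epsilon>"
  shows "measure lebesgue K \<le> cost X w \<epsilon>"
proof -
  have X: "X \<in> lmeasurable" using assms(1) by (rule lmeasurable_compact)
  have w: "integrable lebesgue (\<lambda>x. indicator X x *\<^sub>R w x)"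
    using set_integrable_continuous_compact[OF assms(1,2)] by (simp add: set_integrable_def)
  have X': "integrable lebesgue (\<lambda>x. \<epsilon> * indicator X x :: real)"
    using X by (intro integrable_mult_right integrable_real_indicator) (auto simp: fmeasurable_def)
  have "measure lebesgue K = (LINT x|lebesgue. indicator K x)"
    using K by simp
  also have "\<dots> \<le> (LINT x|lebesgue. indicator X x *\<^sub>R w x + \<epsilon> * indicator X x)"
  proof (rule integral_mono)
    show "integrable lebesgue (indicator K :: _ \<Rightarrow> real)"
      using K by (intro integrable_real_indicator) (auto simp: fmeasurable_def)
    show "integrable lebesgue (\<lambda>x. indicator X x *\<^sub>R w x + \<epsilon> * indicator X x)"
      using w X' by (rule Bochner_Integration.integrable_add)
    show "indicator K x \<le> indicator X x *\<^sub>R w x + \<epsilon> * indicator X x" for x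
      using assms(4-7) by (auto simp: indicator_def)
  qed
  also have "\<dots> = cost X w \<epsilon>"
    using w X' X by (simp add: Bochner_Integration.integral_add cost_def set_lebesgue_integral_def)
  finally show ?thesis .
qed

text \<open>The estimate opposite to \<open>measure_le_cost\<close>; it will be applied with
  \<open>V\<close> a tight open neighbourhood of the attractor and \<open>c\<close> the smoothing
  error.\<close>

lemma cost_le_measure:
  fixes w :: "real ^ 'n \<Rightarrow> real"
  assumes "compact X" "continuous_on X w" and V: "V \<in> lmeasurable"
    and "0 \<le> c" "\<And>x. x \<in> X \<Longrightarrow> w x \<le> indicator V x + c"
  shows "cost X w \<epsilon> \<le> measure lebesgue V + (c + \<epsilon>) * measure lebesgue X"
proof -
  have X: "X \<in> lmeasurable" using assms(1) by (rule lmeasurable_compact)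
  have w: "integrable lebesgue (\<lambda>x. indicator X x *\<^sub>R w x)"
    using set_integrable_continuous_compact[OF assms(1,2)] by (simp add: set_integrable_def)
  have X': "integrable lebesgue (\<lambda>x. c * indicator X x :: real)"
    using X by (intro integrable_mult_right integrable_real_indicator) (auto simp: fmeasurable_def)
  have V': "integrable lebesgue (indicator V :: _ \<Rightarrow> real)"
    using V by (intro integrable_real_indicator) (auto simp: fmeasurable_def)
  have "(LINT x:X|lebesgue. w x) \<le> (LINT x|lebesgue. indicator V x + c * indicator X x)"
    unfolding set_lebesgue_integral_def
  proof (rule integral_mono[OF w])
    show "integrable lebesgue (\<lambda>x. indicator V x + c * indicator X x)"
      using V' X' by (rule Bochner_Integration.integrable_add)
    show "indicator X x *\<^sub>R w x \<le> indicator V x + c * indicator X x" for x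
      using assms(4) assms(5)[of x] by (cases "x \<in> X") auto
  qed
  also have "\<dots> = measure lebesgue V + c * measure lebesgue X"
    using V V' X' X by (simp add: Bochner_Integration.integral_add)
  finally show ?thesis by (simp add: cost_def algebra_simps)
qed

section \<open>Orbits of the original and of the extended field\<close>

context bounded_lipschitz_field
begin

text \<open>A curve that stays in \<open>X\<close> solves both equations or neither, as
  \<open>F\<close> agrees with \<open>f\<close> there. Orbits of \<open>F\<close> exist for all
  time, so they decide membership, and completeness of the \<open>f\<close>-orbit follows.\<close>

lemma max_pos_invariant_iff:
  assumes lip_f: "local_lipschitz (UNIV :: real set) UNIV (\<lambda>_. f)" and F: "\<And>x. x \<in> X \<Longrightarrow> F x = f x"
  shows "x \<in> max_pos_invariant f X \<longleftrightarrow> x \<in> X \<and> (\<forall>t\<ge>0. flow F t x \<in> X)"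
    and "x \<in> max_pos_invariant f X \<Longrightarrow> 0 \<le> t \<Longrightarrow> flow f t x = flow F t x"
proof -
  have f_F: "flow f t x = flow F t x" if x: "x \<in> max_pos_invariant f X" and t: "0 \<le> t" for t
  proof -
    obtain y where y: "solution_upto f x t y"
      using x t by (auto simp: max_pos_invariant_def complete_forward_def)
    \<comment> \<open>A solution restricted to \<open>{0..s}\<close> is again a solution, so
      \<open>y s\<close> is the value of \<open>flow f s x\<close>, which lies in
      \<open>X\<close>.\<close>
    have "y s \<in> X" if "s \<in> {0..t}" for s
      using x flow_eqI[OF lip_f _ solution_upto_antimono[OF y, of s]] that
      by (force simp: max_pos_invariant_def)
    then have "solution_upto F x t y"
      using y F by (simp add: solution_upto_def)
    then show ?thesis
      using flow_eq[OF t] flow_eqI[OF lip_f t y] by simp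
  qed
  have "solution_upto f x t (\<lambda>s. flow F s x)" if "\<forall>t\<ge>0. flow F t x \<in> X" for t
    using flow_solution[of x t] that F by (simp add: solution_upto_def)
  moreover from this have "flow f t x = flow F t x" if "\<forall>t\<ge>0. flow F t x \<in> X" "0 \<le> t" for t
    using flow_eqI[OF lip_f] that by blast
  ultimately have "x \<in> max_pos_invariant f X" if "x \<in> X" "\<forall>t\<ge>0. flow F t x \<in> X"
    using that unfolding max_pos_invariant_def complete_forward_def by auto
  then show "x \<in> max_pos_invariant f X \<longleftrightarrow> x \<in> X \<and> (\<forall>t\<ge>0. flow F t x \<in> X)"
    using f_F by (auto simp: max_pos_invariant_def)
  show "x \<in> max_pos_invariant f X \<Longrightarrow> 0 \<le> t \<Longrightarrow> flow f t x = flow F t x"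
    by (rule f_F)
qed

lemma C1_along_flow:
  assumes "C1 g" "s \<in> {0..t}"
  shows "((\<lambda>s. g (flow F s x)) has_real_derivative grad g (flow F s x) \<bullet> F (flow F s x)) (at s within {0..t})"
proof -
  have "(g has_derivative (\<lambda>h. h \<bullet> grad g (flow F s x))) (at (flow F s x))"
    using C1_GDERIV[OF assms(1)] by (simp add: gderiv_def)
  from has_derivative_compose[OF flow_derivative[OF assms(2), unfolded has_vector_derivative_def] this]
  show ?thesis
    by (simp add: has_field_derivative_def inner_commute mult_commute_abs)
qed

end

subsection \<open>Necessary conditions for feasibility\<close>

locale constrained_field = bounded_lipschitz_field F L B
  for F :: "real ^ 'n \<Rightarrow> real ^ 'n" and L B :: real +
  fixes f :: "real ^ 'n \<Rightarrow> real ^ 'n" and X :: "(real ^ 'n) set"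
  assumes compact_X: "compact X"
    and lip_f: "local_lipschitz (UNIV :: real set) UNIV (\<lambda>_. f)"
    and F_eq: "x \<in> X \<Longrightarrow> F x = f x"
begin

abbreviation M :: "(real ^ 'n) set" where
  "M \<equiv> max_pos_invariant f X"

lemma M_iff: "x \<in> M \<longleftrightarrow> x \<in> X \<and> (\<forall>t\<ge>0. flow F t x \<in> X)"
  using lip_f F_eq by (rule max_pos_invariant_iff)

lemma flow_f_eq: "x \<in> M \<Longrightarrow> 0 \<le> t \<Longrightarrow> flow f t x = flow F t x"
  using lip_f F_eq by (rule max_pos_invariant_iff)

lemma M_flow: "x \<in> M \<Longrightarrow> 0 \<le> t \<Longrightarrow> flow F t x \<in> M"
  by (simp add: M_iff flow_add[symmetric])

lemma M_flow_X: "x \<in> M \<Longrightarrow> 0 \<le> t \<Longrightarrow> flow F t x \<in> X"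
  by (simp add: M_iff)

text \<open>A negative value of \<open>v\<close> would be amplified at rate \<open>\<beta>\<close> along the trajectory, contradicting
  boundedness of \<open>v\<close> on \<open>X\<close>.\<close>

lemma feasible_v_nonneg:
  assumes feas: "feasible \<beta> f X w J \<epsilon> v" and "0 < \<beta>" and x: "x \<in> M"
  shows "0 \<le> v x"
proof (rule ccontr)
  assume "\<not> 0 \<le> v x"
  have v: "C1 v" using feas by (simp add: feasible_def)
  have "compact (v ` X)" by (intro compact_continuous_image C1_continuous_on v compact_X)
  then obtain C where C: "\<And>y. y \<in> X \<Longrightarrow> \<bar>v y\<bar> \<le> C"
    using compact_imp_bounded[of "v ` X"] by (auto simp: bounded_iff)
  have "0 \<le> C" using C[of x] x by (simp add: M_iff)
  \<comment> \<open>Chosen so that \<open>\<beta> * t * v x = - C\<close>: the linear lower bound of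
    the exponential already pushes \<open>v\<close> down to \<open>v x - C\<close>, below
    \<open>- C\<close>.\<close>
  define t where "t = C / (- v x) / \<beta>"
  have t: "0 \<le> t" using \<open>\<not> 0 \<le> v x\<close> \<open>0 \<le> C\<close> \<open>0 < \<beta>\<close> unfolding t_def by (intro divide_nonneg_nonneg) auto
  have "v (flow F t x) \<le> exp (\<beta> * t) * v (flow F 0 x)"
  proof (rule exp_growth_bound[OF t C1_along_flow[OF v]])
    fix s assume "s \<in> {0..t}"
    then have "flow F s x \<in> X" using x by (intro M_flow_X) auto
    then show "grad v (flow F s x) \<bullet> F (flow F s x) \<le> \<beta> * v (flow F s x)"
      using feas F_eq by (force simp: feasible_def)
  qed
  also have "\<dots> \<le> (1 + \<beta> * t) * v x"
    using exp_ge_add_one_self[of "\<beta> * t"] \<open>\<not> 0 \<le> v x\<close> by (simp add: mult_right_mono_neg)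
  also have "\<dots> = v x - C"
    using \<open>\<not> 0 \<le> v x\<close> \<open>0 < \<beta>\<close> by (simp add: t_def field_simps)
  finally show False
    using C[of "flow F t x"] M_flow_X[OF x t] \<open>\<not> 0 \<le> v x\<close> by (auto simp: abs_le_iff)
qed

text \<open>On \<open>M\<close> the function \<open>v\<close> is nonnegative, so the fourth
  constraint becomes \<open>grad J \<bullet> f \<le> - (J - \<epsilon>)\<close>, and Gronwall
  applies to \<open>J - \<epsilon>\<close> with rate -1.\<close>

lemma feasible_J_decay:
  assumes feas: "feasible \<beta> f X w J \<epsilon> v" and "0 < \<beta>" and x: "x \<in> M" and t: "0 \<le> t"
  shows "J (flow F t x) - \<epsilon> \<le> exp (- t) * (J x - \<epsilon>)"
proof -
  have J: "C1 J" using feas by (simp add: feasible_def)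
  have "J (flow F t x) - \<epsilon> \<le> exp (- 1 * t) * (J (flow F 0 x) - \<epsilon>)"
  proof (rule exp_growth_bound[OF t])
    fix s assume s: "s \<in> {0..t}"
    show "((\<lambda>s. J (flow F s x) - \<epsilon>) has_real_derivative grad J (flow F s x) \<bullet> F (flow F s x)) (at s within {0..t})"
      using DERIV_diff[OF C1_along_flow[OF J s] DERIV_const] by simp
    have "flow F s x \<in> M" using x s by (intro M_flow) auto
    then have "0 \<le> v (flow F s x)" "flow F s x \<in> X"
      using feasible_v_nonneg[OF feas \<open>0 < \<beta>\<close>] by (auto simp: M_iff)
    then show "grad J (flow F s x) \<bullet> F (flow F s x) \<le> - 1 * (J (flow F s x) - \<epsilon>)"
      using feas F_eq by (force simp: feasible_def)
  qed
  then show ?thesis by simp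
qed

lemma feasible_positively_invariant:
  assumes feas: "feasible \<beta> f X w J \<epsilon> v" and "0 < \<beta>"
  shows "positively_invariant f (J -` {0..\<epsilon>} \<inter> M)"
  unfolding positively_invariant_def
proof (intro ballI conjI allI impI)
  fix x assume x: "x \<in> J -` {0..\<epsilon>} \<inter> M"
  then show "complete_forward f x" by (simp add: max_pos_invariant_def)
  fix t :: real assume t: "0 \<le> t"
  have M: "flow F t x \<in> M" using x t by (intro M_flow) auto
  then have "0 \<le> J (flow F t x)" using feas by (simp add: feasible_def M_iff)
  moreover have "exp (- t) * (J x - \<epsilon>) \<le> 0" using x by (intro mult_nonneg_nonpos) auto
  then have "J (flow F t x) \<le> \<epsilon>" using feasible_J_decay[OF assms, of x t] x t by auto
  ultimately show "flow f t x \<in> J -` {0..\<epsilon>} \<inter> M"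
    using M flow_f_eq[of x t] x t by auto
qed

text \<open>The Hausdorff distance is two-sided, so every point of \<open>A\<close> is a limit of points \<open>\<phi>\<^sub>t(x)\<close> with
  \<open>x \<in> M\<close> and \<open>t \<rightarrow> \<infinity>\<close>.\<close>

lemma attractor_subset_feasible:
  assumes A: "attracts_in f X A" and feas: "feasible \<beta> f X w J \<epsilon> v" and "0 < \<beta>"
  shows "A \<subseteq> J -` {0..\<epsilon>} \<inter> v -` {0..} \<inter> X"
proof
  fix a assume a: "a \<in> A"
  have "a \<in> X" using A a by (auto simp: attracts_in_def)
  have J: "C1 J" and v: "C1 v" using feas by (auto simp: feasible_def)
  have "compact (J ` X)" by (intro compact_continuous_image C1_continuous_on J compact_X)
  then obtain C where C: "\<And>y. y \<in> X \<Longrightarrow> \<bar>J y\<bar> \<le> C"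
    using compact_imp_bounded[of "J ` X"] by (auto simp: bounded_iff)
  \<comment> \<open>The starting point \<open>x\<close> depends on \<open>t\<close>, so the initial
    excess \<open>J x - \<epsilon>\<close> is replaced by the bound
    \<open>C + \<bar>\<epsilon>\<bar>\<close>, valid on all of \<open>X\<close>.\<close>
  have "\<exists>x\<in>M. \<exists>t\<ge>0. exp (- t) * (C + \<bar>\<epsilon>\<bar>) < r \<and> dist (flow F t x) a < r" if "0 < r" for r
  proof -
    have "((\<lambda>t. exp (- t) * (C + \<bar>\<epsilon>\<bar>)) \<longlongrightarrow> 0 * (C + \<bar>\<epsilon>\<bar>)) at_top"
      by (intro tendsto_intros filterlim_compose[OF exp_at_bot] filterlim_uminus_at_bot_at_top)
    then have "\<forall>\<^sub>F t in at_top. exp (- t) * (C + \<bar>\<epsilon>\<bar>) < r"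
      using that by (intro order_tendstoD) auto
    moreover have "\<forall>\<^sub>F t in at_top. \<forall>a\<in>A. \<exists>x\<in>flow f t ` M. dist a x < r"
      using A that by (auto simp: attracts_in_def dest!: hausdorff_dist_tendsto_0D elim: eventually_mono)
    ultimately have "\<forall>\<^sub>F t in at_top. 0 \<le> t \<and> exp (- t) * (C + \<bar>\<epsilon>\<bar>) < r \<and>
        (\<forall>a\<in>A. \<exists>x\<in>flow f t ` M. dist a x < r)"
      using eventually_ge_at_top[of "0::real"] by eventually_elim auto
    then obtain t where t: "0 \<le> t" "exp (- t) * (C + \<bar>\<epsilon>\<bar>) < r"
      "\<forall>a\<in>A. \<exists>x\<in>flow f t ` M. dist a x < r"
      using eventually_happens'[OF trivial_limit_at_top_linorder] by blast
    then show ?thesis using a flow_f_eq by (force simp: dist_commute)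
  qed
  note near = this
  have "J a \<le> \<epsilon>"
  proof (rule le_at_limit_point[OF C1_continuous_on[OF J]])
    fix r :: real assume "0 < r"
    then obtain x t where x: "x \<in> M" "0 \<le> t" "exp (- t) * (C + \<bar>\<epsilon>\<bar>) < r" "dist (flow F t x) a < r"
      using near by blast
    have "J x - \<epsilon> \<le> C + \<bar>\<epsilon>\<bar>" using C[of x] x(1) by (auto simp: M_iff)
    then have "exp (- t) * (J x - \<epsilon>) \<le> exp (- t) * (C + \<bar>\<epsilon>\<bar>)" by (intro mult_left_mono) auto
    then have "J (flow F t x) \<le> \<epsilon> + r"
      using feasible_J_decay[OF feas \<open>0 < \<beta>\<close> x(1,2)] x(3) by linarith
    then show "\<exists>y. dist y a < r \<and> J y \<le> \<epsilon> + r" using x(4) by blast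
  qed
  moreover have "- v a \<le> 0"
  proof (rule le_at_limit_point[of "\<lambda>x. - v x"])
    show "continuous_on UNIV (\<lambda>x. - v x)" by (intro continuous_intros C1_continuous_on v)
    fix r :: real assume "0 < r"
    then obtain x t where x: "x \<in> M" "0 \<le> t" "dist (flow F t x) a < r"
      using near by blast
    then have "- v (flow F t x) \<le> 0 + r"
      using feasible_v_nonneg[OF feas \<open>0 < \<beta>\<close> M_flow[OF x(1,2)]] \<open>0 < r\<close> by simp
    then show "\<exists>y. dist y a < r \<and> - v y \<le> 0 + r" using x(3) by blast
  qed
  moreover have "0 \<le> J a" using feas \<open>a \<in> X\<close> by (simp add: feasible_def)
  ultimately show "a \<in> J -` {0..\<epsilon>} \<inter> v -` {0..} \<inter> X" using \<open>a \<in> X\<close> by auto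
qed

lemma compact_feasible_set:
  assumes "feasible \<beta> f X w J \<epsilon> v"
  shows "compact (J -` {0..\<epsilon>} \<inter> v -` {0..} \<inter> X)"
proof -
  have "closed (J -` {0..\<epsilon>})" "closed (v -` {0..})"
    using assms C1_continuous_on[of J UNIV] C1_continuous_on[of v UNIV]
    by (auto simp: feasible_def intro!: closed_vimage)
  then show ?thesis
    using compact_X by (intro closed_Int_compact closed_Int)
qed

text \<open>Where \<open>J \<le> \<epsilon>\<close> and \<open>v \<ge> 0\<close>, the first
  constraint reads \<open>w + \<epsilon> \<ge> 1\<close>.\<close>

lemma measure_feasible_set_le_cost:
  assumes feas: "feasible \<beta> f X w J \<epsilon> v"
  shows "measure lebesgue (J -` {0..\<epsilon>} \<inter> v -` {0..} \<inter> X) \<le> cost X w \<epsilon>"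
proof (rule measure_le_cost[OF compact_X])
  show "J -` {0..\<epsilon>} \<inter> v -` {0..} \<inter> X \<in> lmeasurable"
    using compact_feasible_set[OF feas] by (rule lmeasurable_compact)
  show "1 \<le> w x + \<epsilon>" if "x \<in> J -` {0..\<epsilon>} \<inter> v -` {0..} \<inter> X" for x
  proof -
    have "1 \<le> w x + J x - v x" using feas that by (simp add: feasible_def)
    then show ?thesis using that by simp
  qed
qed (use feas in \<open>auto simp: feasible_def\<close>)

end


section \<open>Smoothing to a prescribed accuracy, and exit times\<close>

context bounded_lipschitz_field
begin

lemma smooth_approximation_within:
  fixes u :: "real ^ 'n \<Rightarrow> real"
  assumes u: "K-lipschitz_on UNIV u" and "0 < e" "0 < r"
  obtains U where "C1 U" "\<And>x. \<bar>U x - u x\<bar> \<le> e"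
    "\<And>x k d h0. 0 < h0 \<Longrightarrow>
      (\<And>y h. dist x y < r \<Longrightarrow> 0 < h \<Longrightarrow> h < h0 \<Longrightarrow> u (flow F h y) \<le> u y + h * (k * u y + d)) \<Longrightarrow>
      grad U x \<bullet> F x \<le> k * U x + d + e"
proof -
  have K: "0 \<le> K" using u by (rule lipschitz_on_nonneg)
  \<comment> \<open>\<open>c * \<eta>\<close> dominates both the sup-norm error and the derivative
    error; the summand 1 keeps \<open>c\<close> positive when \<open>K\<close> is 0.\<close>
  define c where "c = K * (1 + L) + 1"
  define \<eta> where "\<eta> = min r (e / c)"
  have c: "0 < c" using K L_nonneg by (simp add: c_def add_nonneg_pos)
  have "0 < \<eta>" using c \<open>0 < e\<close> \<open>0 < r\<close> by (simp add: \<eta>_def)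
  have "c * \<eta> \<le> c * (e / c)" using c by (intro mult_left_mono) (auto simp: \<eta>_def)
  then have "c * \<eta> \<le> e" using c by simp
  then have "K * \<eta> + K * L * \<eta> + \<eta> \<le> e" by (simp add: c_def algebra_simps)
  moreover have "0 \<le> K * \<eta>" "0 \<le> K * L * \<eta>" using K L_nonneg \<open>0 < \<eta>\<close> by auto
  ultimately have small: "K * \<eta> \<le> e" "K * L * \<eta> \<le> e" using \<open>0 < \<eta>\<close> by linarith+
  obtain U where U: "C1 U" "\<And>x. \<bar>U x - u x\<bar> \<le> K * \<eta>"
    "\<And>x k d h0. 0 < h0 \<Longrightarrow>
      (\<And>y h. dist x y < \<eta> \<Longrightarrow> 0 < h \<Longrightarrow> h < h0 \<Longrightarrow> u (flow F h y) \<le> u y + h * (k * u y + d)) \<Longrightarrow>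
      grad U x \<bullet> F x \<le> k * U x + d + K * L * \<eta>"
    by (rule smooth_approximation[OF u \<open>0 < \<eta>\<close>]) blast
  show ?thesis
  proof (rule that[of U])
    show "\<bar>U x - u x\<bar> \<le> e" for x using U(2)[of x] small(1) by linarith
    fix x k d and h0 :: real
    assume "0 < h0" and flow: "\<And>y h. dist x y < r \<Longrightarrow> 0 < h \<Longrightarrow> h < h0 \<Longrightarrow> u (flow F h y) \<le> u y + h * (k * u y + d)"
    have "grad U x \<bullet> F x \<le> k * U x + d + K * L * \<eta>"
      using \<open>0 < h0\<close> by (rule U(3)) (auto intro!: flow simp: \<eta>_def)
    then show "grad U x \<bullet> F x \<le> k * U x + d + e" using small(2) by linarith
  qed (rule U(1))
qed

text \<open>Compactness by contradiction: points that stay within \<open>1 / Suc n\<close> of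
  \<open>X\<close> up to time \<open>n\<close> accumulate at a point whose whole orbit lies in
  \<open>X\<close>, while they keep distance \<open>\<delta>\<close> from all such points. The
  factor 2 leaves room for a cut-off vanishing on the \<open>\<eta>\<close>-neighbourhood of
  \<open>X\<close>.\<close>

lemma uniform_exit_time:
  assumes "compact X" "0 < \<delta>"
  obtains T \<eta> where "0 \<le> T" "0 < \<eta>"
    "\<And>x. x \<in> X \<Longrightarrow> (\<And>m. m \<in> X \<Longrightarrow> \<forall>t\<ge>0. flow F t m \<in> X \<Longrightarrow> \<delta> \<le> dist x m) \<Longrightarrow>
      \<exists>t\<in>{0..T}. 2 * \<eta> \<le> infdist (flow F t x) X"
proof -
  have "\<exists>n::nat. \<forall>x\<in>X. (\<forall>m\<in>X. (\<forall>t\<ge>0. flow F t m \<in> X) \<longrightarrow> \<delta> \<le> dist x m) \<longrightarrow>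
      (\<exists>t\<in>{0..real n}. 1 / real (Suc n) \<le> infdist (flow F t x) X)"
  proof (rule ccontr)
    assume "\<not> ?thesis"
    then have "\<forall>n. \<exists>x\<in>X. (\<forall>m\<in>X. (\<forall>t\<ge>0. flow F t m \<in> X) \<longrightarrow> \<delta> \<le> dist x m) \<and>
        (\<forall>t\<in>{0..real n}. infdist (flow F t x) X < 1 / real (Suc n))"
      by (simp add: not_le[symmetric])
    then obtain x where x: "\<And>n. x n \<in> X"
      "\<And>n m. m \<in> X \<Longrightarrow> \<forall>t\<ge>0. flow F t m \<in> X \<Longrightarrow> \<delta> \<le> dist (x n) m"
      "\<And>n t. t \<in> {0..real n} \<Longrightarrow> infdist (flow F t (x n)) X < 1 / real (Suc n)"
      by metis
    obtain l r where l: "l \<in> X" "strict_mono r" "(x \<circ> r) \<longlonglongrightarrow> l"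
      using assms(1) x(1) unfolding compact_def by metis
    have "flow F t l \<in> X" if t: "0 \<le> t" for t
    proof -
      have "infdist (flow F t l) X \<le> 0"
      proof (rule tendsto_lowerbound)
        show "((\<lambda>n. 1 / real (Suc n) + exp (L * t) * dist l ((x \<circ> r) n)) \<longlonglongrightarrow> 0)"
        proof -
          have "(\<lambda>n. 1 / real (Suc n)) \<longlonglongrightarrow> 0" by (rule LIMSEQ_Suc[OF lim_1_over_n])
          moreover have "(\<lambda>n. exp (L * t) * dist l ((x \<circ> r) n)) \<longlonglongrightarrow> exp (L * t) * dist l l"
            by (intro tendsto_intros l(3))
          ultimately show ?thesis using tendsto_add by fastforce
        qed
        \<comment> \<open>From \<open>n \<ge> t\<close> on, \<open>r n \<ge> n\<close> puts
          \<open>t\<close> into the interval on which the orbit of \<open>x (r n)\<close> is known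
          to stay close to \<open>X\<close>.\<close>
        show "\<forall>\<^sub>F n in sequentially.
            infdist (flow F t l) X \<le> 1 / real (Suc n) + exp (L * t) * dist l ((x \<circ> r) n)"
          using eventually_ge_at_top[of "nat \<lceil>t\<rceil>"]
        proof eventually_elim
          case (elim n)
          have "n \<le> r n" using l(2) by (rule seq_suble)
          then have "infdist (flow F t (x (r n))) X < 1 / real (Suc (r n))"
            using elim t by (intro x(3)) (auto simp: le_nat_iff nat_ceiling_le_eq)
          also have "\<dots> \<le> 1 / real (Suc n)"
            using \<open>n \<le> r n\<close> by (intro divide_left_mono) auto
          finally have "infdist (flow F t (x (r n))) X < 1 / real (Suc n)" .
          moreover have "infdist (flow F t l) X \<le> infdist (flow F t (x (r n))) X + dist (flow F t l) (flow F t (x (r n)))"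
            by (rule infdist_triangle)
          moreover have "dist (flow F t l) (flow F t (x (r n))) \<le> exp (L * t) * dist l (x (r n))"
            using t by (rule flow_dist_le)
          ultimately show ?case by simp
        qed
      qed simp
      then have "infdist (flow F t l) X = 0" using infdist_nonneg[of "flow F t l" X] by linarith
      then show ?thesis
        using in_closed_iff_infdist_zero[of X] compact_imp_closed[OF assms(1)] l(1) by blast
    qed
    then have "\<delta> \<le> dist (x (r n)) l" for n using l(1) by (intro x(2)) auto
    moreover have "\<forall>\<^sub>F n in sequentially. dist ((x \<circ> r) n) l < \<delta>"
      using l(3) \<open>0 < \<delta>\<close> by (rule tendstoD)
    then obtain n where "dist ((x \<circ> r) n) l < \<delta>"
      using eventually_happens'[OF sequentially_bot] by blast
    ultimately show False by (simp add: not_le[symmetric])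
  qed
  then obtain n :: nat where n: "\<forall>x\<in>X. (\<forall>m\<in>X. (\<forall>t\<ge>0. flow F t m \<in> X) \<longrightarrow> \<delta> \<le> dist x m) \<longrightarrow>
      (\<exists>t\<in>{0..real n}. 1 / real (Suc n) \<le> infdist (flow F t x) X)"
    by blast
  show ?thesis
  proof (rule that[of "real n" "1 / real (Suc n) / 2"])
    fix x assume "x \<in> X" "\<And>m. m \<in> X \<Longrightarrow> \<forall>t\<ge>0. flow F t m \<in> X \<Longrightarrow> \<delta> \<le> dist x m"
    then have "\<exists>t\<in>{0..real n}. 1 / real (Suc n) \<le> infdist (flow F t x) X" using n by blast
    moreover have "2 * (a / 2) = a" for a :: real by simp
    ultimately show "\<exists>t\<in>{0..real n}. 2 * (1 / real (Suc n) / 2) \<le> infdist (flow F t x) X"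
      by (simp only:)
  qed auto
qed

end

section \<open>Ingredients of cut-off functions\<close>

lemma lipschitz_max_0:
  fixes g :: "'a::metric_space \<Rightarrow> real"
  assumes "K-lipschitz_on S g"
  shows "K-lipschitz_on S (\<lambda>x. max 0 (g x))"
proof (rule lipschitz_onI)
  fix x y assume "x \<in> S" "y \<in> S"
  then have "\<bar>g x - g y\<bar> \<le> K * dist x y" using lipschitz_onD[OF assms] by (simp add: dist_real_def)
  then show "dist (max 0 (g x)) (max 0 (g y)) \<le> K * dist x y" by (simp add: dist_real_def)
qed (rule lipschitz_on_nonneg[OF assms])

lemma lipschitz_infdist: "1-lipschitz_on S (\<lambda>x. infdist x A)"
  by (intro lipschitz_onI) (auto simp: dist_real_def infdist_triangle_abs)

text \<open>\<open>V \<noteq> UNIV\<close> follows from finite measure; it keeps \<open>- V\<close>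
  nonempty, so that \<open>infdist\<close> to it is a true distance and not the default 0.\<close>

lemma lmeasurable_outer_open:
  fixes A :: "'a::euclidean_space set"
  assumes "compact A" "0 < e"
  obtains V where "open V" "A \<subseteq> V" "V \<in> lmeasurable" "measure lebesgue V \<le> measure lebesgue A + e" "V \<noteq> UNIV"
proof -
  have A: "A \<in> lmeasurable" using assms(1) by (rule lmeasurable_compact)
  then obtain V where V: "open V" "A \<subseteq> V" "V - A \<in> lmeasurable" "emeasure lebesgue (V - A) < ennreal e"
    using sets_lebesgue_outer_open[of A e] assms(2) by (auto simp: fmeasurable_def)
  have eq: "V = A \<union> (V - A)" using V(2) by blast
  have "A \<union> (V - A) \<in> lmeasurable" using A V(3) by (rule fmeasurable.Un)
  then have V_meas: "V \<in> lmeasurable" using eq by simp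
  have "measure lebesgue (V - A) < e"
    using V(3,4) assms(2) by (simp add: emeasure_eq_measure2 ennreal_less_iff)
  moreover have "measure lebesgue V \<le> measure lebesgue A + measure lebesgue (V - A)"
    using measure_Un_le[of A lebesgue "V - A"] A V(3) eq by (auto simp: fmeasurable_def)
  moreover have "V \<noteq> UNIV"
    using V_meas by (auto simp: fmeasurable_def)
  ultimately show ?thesis using V V_meas by (intro that[of V]) auto
qed

subsection \<open>Near-optimal feasible points\<close>

context constrained_field
begin

text \<open>The neighbourhood \<open>V\<close> spends one half of \<open>e\<close>, the smoothing
  error \<open>e1\<close> the other. \<open>J\<close> is built first, since \<open>v\<close> has to
  outweigh the bound \<open>D\<close> on the derivative of \<open>J\<close>.\<close>

lemma near_optimal_feasible:
  assumes A: "attracts_in f X A" and "0 < \<beta>" "0 < e"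
  shows "\<exists>w J \<epsilon> v. feasible \<beta> f X w J \<epsilon> v \<and> cost X w \<epsilon> \<le> measure lebesgue A + e"
proof -
  have "compact A" using A by (simp add: attracts_in_def)
  obtain V where V: "open V" "A \<subseteq> V" "V \<in> lmeasurable"
    "measure lebesgue V \<le> measure lebesgue A + e / 2" "V \<noteq> UNIV"
    using lmeasurable_outer_open[OF \<open>compact A\<close>, of "e / 2"] \<open>0 < e\<close> by auto
  \<comment> \<open>The excess will be \<open>(4 + 2 / \<beta>) * e1\<close> times the volume of
    \<open>X\<close>: \<open>e1 + e1 / \<beta>\<close> comes from \<open>w\<close> and
    \<open>3 * e1 + e1 / \<beta>\<close> from \<open>\<epsilon>\<close>. Adding 1 to the volume
    avoids dividing by zero for null sets.\<close>
  define e1 where "e1 = e / 2 / ((4 + 2 / \<beta>) * (measure lebesgue X + 1))"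
  have b: "0 < (4 + 2 / \<beta>) * (measure lebesgue X + 1)"
    using \<open>0 < \<beta>\<close> measure_nonneg[of lebesgue X] by (intro mult_pos_pos add_pos_pos add_nonneg_pos) auto
  then have "0 < e1" using \<open>0 < e\<close> by (simp add: e1_def)
  have "(4 + 2 / \<beta>) * e1 * measure lebesgue X \<le> (4 + 2 / \<beta>) * e1 * (measure lebesgue X + 1)"
    using \<open>0 < e1\<close> \<open>0 < \<beta>\<close> by (intro mult_left_mono) auto
  also have "\<dots> = (4 + 2 / \<beta>) * (measure lebesgue X + 1) * e1" by (simp only: mult_ac)
  also have "\<dots> = e / 2"
  proof -
    have "P * (e / 2 / P) = e / 2" if "0 < P" for P :: real using that by simp
    from this[OF b] show ?thesis by (simp only: e1_def)
  qed
  finally have e1: "(4 + 2 / \<beta>) * e1 * measure lebesgue X \<le> e / 2" .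

  obtain r where r: "0 < r" "\<And>a y. a \<in> A \<Longrightarrow> y \<in> - V \<Longrightarrow> r \<le> dist a y"
    using separate_compact_closed[OF \<open>compact A\<close> closed_Compl[OF V(1)]] V(2) by blast
  \<comment> \<open>The cut-off equals 1 off \<open>V\<close> and reaches 0 at depth
    \<open>r / 4\<close>. Points of \<open>A\<close> have depth \<open>r\<close>, late orbits of
    \<open>M\<close> depth \<open>r / 2\<close>, and nearby orbits may lose a further
    \<open>r / 4\<close>.\<close>
  define g where "g z = max 0 (1 - 4 / r * infdist z (- V))" for z
  have g_lip: "(4 / r)-lipschitz_on UNIV g"
  proof -
    have "(0 + 4 / r * 1)-lipschitz_on UNIV (\<lambda>z. 1 - 4 / r * infdist z (- V))"
      using r(1) by (intro lipschitz_on_diff lipschitz_on_constant lipschitz_on_cmult_real_nonneg lipschitz_infdist) auto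
    then show ?thesis unfolding g_def by (intro lipschitz_max_0) simp
  qed
  have g_nonneg: "0 \<le> g z" for z by (simp add: g_def)
  have g_le: "g z \<le> 1" for z using r(1) by (simp add: g_def infdist_nonneg)
  have g_0: "g z = 0" if "r / 4 \<le> infdist z (- V)" for z
    using that r(1) by (simp add: g_def field_simps)
  have g_1: "g z = 1" if "z \<notin> V" for z using that by (simp add: g_def)
  obtain T where T: "0 \<le> T" "\<And>t m. T \<le> t \<Longrightarrow> m \<in> M \<Longrightarrow> r / 2 \<le> infdist (flow F t m) (- V)"
  proof -
    have "\<forall>\<^sub>F t in at_top. \<forall>x\<in>flow f t ` M. \<exists>a\<in>A. dist x a < r / 2"
      using A r(1) by (auto simp: attracts_in_def dest!: hausdorff_dist_tendsto_0D[where r = "r / 2"] elim: eventually_mono)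
    then obtain T where T: "\<And>t x. T \<le> t \<Longrightarrow> x \<in> flow f t ` M \<Longrightarrow> \<exists>a\<in>A. dist x a < r / 2"
      unfolding eventually_at_top_linorder by blast
    show ?thesis
    proof (rule that[of "max 0 T"])
      fix t m assume t: "max 0 T \<le> t" and m: "m \<in> M"
      then have "flow F t m \<in> flow f t ` M" using flow_f_eq[of m t] by force
      then obtain a where a: "a \<in> A" "dist (flow F t m) a < r / 2" using T[of t] t by auto
      have V_ne: "- V \<noteq> {}" using V(5) by blast
      have "r / 2 \<le> dist (flow F t m) y" if "y \<in> - V" for y
        using r(2)[OF a(1) that] a(2) dist_triangle3[of a y "flow F t m"] by linarith
      then show "r / 2 \<le> infdist (flow F t m) (- V)"
        unfolding infdist_notempty[OF V_ne] by (rule cINF_greatest[OF V_ne])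
    qed simp
  qed
  \<comment> \<open>Starting \<open>\<delta>\<close>-close to \<open>M\<close> keeps orbits
    \<open>r / 4\<close>-close up to time \<open>T + 1\<close>; the extra unit of time covers the
    window \<open>T \<le> s \<le> T + h\<close> of \<open>orbit_sup_flow_le\<close>.\<close>
  define \<delta> where "\<delta> = r / 4 * exp (- (L * (T + 1)))"
  have \<delta>: "0 < \<delta>" using r(1) by (simp add: \<delta>_def)
  have g_flow_0: "g (flow F s y) = 0"
    if "m \<in> M" "dist y m < \<delta>" "T \<le> s" "s \<le> T + 1" for m y s
  proof (rule g_0)
    have "0 \<le> s" using that T(1) by simp
    have "dist (flow F s m) (flow F s y) \<le> exp (L * s) * dist m y"
      using \<open>0 \<le> s\<close> by (rule flow_dist_le)
    also have "\<dots> \<le> exp (L * (T + 1)) * \<delta>"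
      using that L_nonneg by (intro mult_mono) (auto simp: dist_commute intro: mult_left_mono)
    also have "\<dots> = r / 4" by (simp add: \<delta>_def exp_minus)
    finally have "dist (flow F s m) (flow F s y) \<le> r / 4" .
    then show "r / 4 \<le> infdist (flow F s y) (- V)"
      using T(2)[OF that(3,1)] infdist_triangle[of "flow F s m" "- V" "flow F s y"] by linarith
  qed

  \<comment> \<open>The weight \<open>exp (2 * t)\<close> makes \<open>J0\<close> decay at rate 2, which leaves the margin needed for the
    Euler-type bound with rate 1 below.\<close>
  define J0 where "J0 = orbit_sup 2 g T"
  note sup_g = g_lip g_nonneg T(1)
  obtain KJ where J0_lip: "KJ-lipschitz_on UNIV J0"
    using orbit_sup_lipschitz[OF sup_g] unfolding J0_def by blast
  have J0_ge: "g x \<le> J0 x" "0 \<le> J0 x" for x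
    unfolding J0_def using sup_g by (rule le_orbit_sup orbit_sup_nonneg)+
  have J0_le: "J0 x \<le> exp (2 * T)" for x
    unfolding J0_def
  proof (rule orbit_sup_le[OF sup_g])
    fix t assume "t \<in> {0..T}"
    then have "exp (2 * t) * g (flow F t x) \<le> exp (2 * T) * 1"
      using g_le g_nonneg by (intro mult_mono) auto
    then show "exp (2 * t) * g (flow F t x) \<le> exp (2 * T)" by simp
  qed
  have J0_decay: "J0 (flow F h y) \<le> J0 y + h * ((- 1) * J0 y + 0)"
    if "m \<in> M" "dist y m < \<delta>" "0 < h" "h < 1 / 2" for m y h
  proof -
    have "J0 (flow F h y) \<le> exp (- 2 * h) * J0 y"
      unfolding J0_def using that by (intro orbit_sup_flow_le[OF sup_g] g_flow_0) auto
    also have "\<dots> \<le> (1 - h) * J0 y"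
    proof (rule mult_right_mono[OF _ J0_ge(2)])
      \<comment> \<open>This is where \<open>h < 1 / 2\<close> enters:
        \<open>1 / (1 + 2 * h)\<close> bounds \<open>exp (- 2 * h)\<close> from above and is at most
        \<open>1 - h\<close>.\<close>
      have "(1 - h) * (1 + 2 * h) = 1 + h * (1 - 2 * h)" by (simp add: algebra_simps)
      also have "1 \<le> \<dots>" using that by simp
      finally have "1 / (1 + 2 * h) \<le> 1 - h" using that by (simp add: pos_divide_le_eq)
      moreover have "exp (- 2 * h) \<le> 1 / (1 + 2 * h)"
        using exp_ge_add_one_self[of "2 * h"] that by (simp add: exp_minus inverse_eq_divide frac_le)
      ultimately show "exp (- 2 * h) \<le> 1 - h" by (rule order_trans[rotated])
    qed
    finally show ?thesis by (simp add: algebra_simps)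
  qed
  \<comment> \<open>Far from \<open>M\<close> nothing better than Lipschitz constant times speed is
    available, hence rate 0 and a constant defect.\<close>
  have J0_growth: "J0 (flow F h y) \<le> J0 y + h * (0 * J0 y + KJ * B)" if "0 < h" for y h
  proof -
    have "J0 (flow F h y) \<le> J0 y + KJ * dist (flow F h y) y"
      using lipschitz_onD[OF J0_lip, of "flow F h y" y] by (simp add: dist_real_def abs_le_iff)
    also have "\<dots> \<le> J0 y + KJ * (B * h)"
      using that by (intro add_left_mono mult_left_mono flow_speed lipschitz_on_nonneg[OF J0_lip]) auto
    finally show ?thesis by (simp add: mult_ac)
  qed
  \<comment> \<open>With averaging radius \<open>\<delta> / 2\<close>, all points averaged around an
    \<open>x\<close> that is \<open>\<delta> / 2\<close>-close to \<open>M\<close> remain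
    \<open>\<delta>\<close>-close to it.\<close>
  obtain J1 where J1: "C1 J1" "\<And>x. \<bar>J1 x - J0 x\<bar> \<le> e1"
    "\<And>x k d h0. 0 < h0 \<Longrightarrow>
      (\<And>y h. dist x y < \<delta> / 2 \<Longrightarrow> 0 < h \<Longrightarrow> h < h0 \<Longrightarrow> J0 (flow F h y) \<le> J0 y + h * (k * J0 y + d)) \<Longrightarrow>
      grad J1 x \<bullet> F x \<le> k * J1 x + d + e1"
    by (rule smooth_approximation_within[OF J0_lip \<open>0 < e1\<close> half_gt_zero[OF \<delta>]]) blast
  \<comment> \<open>The shift by \<open>e1\<close> restores \<open>J \<ge> J0\<close>, and with it
    \<open>J \<ge> 0\<close> everywhere and \<open>J \<ge> 1\<close> off \<open>V\<close>.\<close>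
  define J where "J x = J1 x + e1" for x
  have J: "C1 J" "grad J = grad J1"
    unfolding J_def[abs_def] using J1(1) by (rule C1_add_const)+
  have J_ge: "J0 x \<le> J x" and J_le: "J x \<le> J0 x + 2 * e1" for x
    using J1(2)[of x] by (auto simp: J_def abs_le_iff)
  \<comment> \<open>\<open>KJ * B + e1\<close> bounds the derivative of \<open>J\<close> along the
    field, \<open>exp (2 * T) + 2 * e1\<close> bounds \<open>J\<close> itself.\<close>
  define D where "D = KJ * B + exp (2 * T) + 3 * e1"
  have J_far: "grad J x \<bullet> F x + J x \<le> D" for x
  proof -
    have "grad J1 x \<bullet> F x \<le> 0 * J1 x + KJ * B + e1"
      by (rule J1(3)[of 1]) (auto intro: J0_growth[simplified])
    then show ?thesis using J_le[of x] J0_le[of x] by (simp add: J D_def)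
  qed
  have J_near: "grad J x \<bullet> F x + J x \<le> 2 * e1" if m: "m \<in> M" "dist x m < \<delta> / 2" for x m
  proof -
    have "grad J1 x \<bullet> F x \<le> (- 1) * J1 x + 0 + e1"
    proof (rule J1(3)[of "1 / 2"])
      fix y :: "real ^ 'n" and h :: real assume y: "dist x y < \<delta> / 2" and h: "0 < h" "h < 1 / 2"
      have "dist y m < \<delta>" using dist_triangle3[of y m x] y m(2) by linarith
      then show "J0 (flow F h y) \<le> J0 y + h * ((- 1) * J0 y + 0)" using J0_decay[OF m(1)] h by blast
    qed simp
    then show ?thesis by (simp add: J J_def)
  qed

  obtain T2 \<eta> where T2: "0 \<le> T2" "0 < \<eta>" and exit: "\<And>x. x \<in> X \<Longrightarrow>
      (\<And>m. m \<in> X \<Longrightarrow> \<forall>t\<ge>0. flow F t m \<in> X \<Longrightarrow> \<delta> / 2 \<le> dist x m) \<Longrightarrow>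
      \<exists>t\<in>{0..T2}. 2 * \<eta> \<le> infdist (flow F t x) X"
    by (rule uniform_exit_time[OF compact_X half_gt_zero[OF \<delta>]]) blast
  \<comment> \<open>It vanishes on the \<open>\<eta>\<close>-neighbourhood of \<open>X\<close> and
    is at least \<open>\<eta>\<close> at the exit times supplied by
    \<open>uniform_exit_time\<close>.\<close>
  define g2 where "g2 z = max 0 (infdist z X - \<eta>)" for z
  have g2_lip: "1-lipschitz_on UNIV g2"
  proof -
    have "(1 + 0)-lipschitz_on UNIV (\<lambda>z. infdist z X - \<eta>)"
      by (intro lipschitz_on_diff lipschitz_infdist lipschitz_on_constant)
    then show ?thesis unfolding g2_def by (intro lipschitz_max_0) simp
  qed
  have g2_nonneg: "0 \<le> g2 z" for z by (simp add: g2_def)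
  note sup_g2 = g2_lip g2_nonneg T2(1)
  define S where "S = orbit_sup (- \<beta>) g2 T2"
  obtain KS where S_lip: "KS-lipschitz_on UNIV S"
    using orbit_sup_lipschitz[OF sup_g2] unfolding S_def by blast
  have S_nonneg: "0 \<le> S x" for x
    unfolding S_def using sup_g2 by (rule orbit_sup_nonneg)
  have "0 \<le> KJ * B" using lipschitz_on_nonneg[OF J0_lip] B_nonneg by simp
  then have "0 \<le> D" using \<open>0 < e1\<close> by (simp add: D_def)
  \<comment> \<open>Scaling by \<open>C\<close> makes \<open>v\<close> outweigh the uncontrolled derivative of \<open>J\<close> away from \<open>M\<close>.\<close>
  define C where "C = D * exp (\<beta> * T2) / \<eta>"
  have C: "0 \<le> C" using \<open>0 \<le> D\<close> T2(2) by (simp add: C_def)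
  define u where "u x = - (C * S x)" for x
  have u_lip: "(C * KS)-lipschitz_on UNIV u"
    unfolding u_def[abs_def] using C S_lip by (intro lipschitz_on_minus lipschitz_on_cmult_real_nonneg)
  have u_le: "u x \<le> 0" for x using C S_nonneg[of x] by (simp add: u_def)
  have u_far: "u x \<le> - D" if x: "x \<in> X" and far: "\<And>m. m \<in> M \<Longrightarrow> \<delta> / 2 \<le> dist x m" for x
  proof -
    obtain t where t: "t \<in> {0..T2}" "2 * \<eta> \<le> infdist (flow F t x) X"
      using exit[OF x] far by (auto simp: M_iff)
    have "exp (- \<beta> * T2) * \<eta> \<le> exp (- \<beta> * t) * g2 (flow F t x)"
      using t T2 \<open>0 < \<beta>\<close> by (intro mult_mono) (auto simp: g2_def)
    also have "\<dots> \<le> S x"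
      unfolding S_def using t(1) by (rule orbit_sup_ge[OF sup_g2])
    finally have "C * (exp (- \<beta> * T2) * \<eta>) \<le> C * S x" using C by (rule mult_left_mono)
    moreover have "C * (exp (- \<beta> * T2) * \<eta>) = D" using T2(2) by (simp add: C_def exp_minus)
    ultimately show ?thesis by (simp add: u_def)
  qed
  \<comment> \<open>Within time \<open>h1\<close> an orbit moves at most \<open>\<eta> / 2\<close>,
    so from points \<open>\<eta> / 2\<close>-close to \<open>X\<close> it stays where
    \<open>g2\<close> vanishes.\<close>
  define h1 where "h1 = \<eta> / (2 * (B + 1))"
  have h1_eq: "(B + 1) * h1 = \<eta> / 2"
  proof -
    have "c * (\<eta> / (2 * c)) = \<eta> / 2" if "0 < c" for c :: real using that by simp
    from this[of "B + 1"] show ?thesis using B_nonneg by (simp add: h1_def)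
  qed
  have h1: "0 < h1" using T2(2) B_nonneg by (simp add: h1_def)
  have u_growth: "u (flow F h y) \<le> u y + h * (\<beta> * u y + 0)"
    if x: "x \<in> X" and y: "dist x y < \<eta> / 2" and h: "0 < h" "h < h1" for x y h
  proof -
    have "exp (- (- \<beta>) * h) * S y \<le> S (flow F h y)"
      unfolding S_def
    proof (rule orbit_sup_flow_ge[OF sup_g2])
      fix s assume s: "0 \<le> s" "s \<le> h"
      have "infdist (flow F s y) X \<le> dist (flow F s y) x" using x by (rule infdist_le)
      also have "\<dots> \<le> dist (flow F s y) y + dist x y" using dist_triangle[of "flow F s y" x y] by (simp add: dist_commute[of x y])
      also have "dist (flow F s y) y \<le> B * s" using s(1) by (rule flow_speed)
      also have "B * s \<le> (B + 1) * h1" using s h B_nonneg by (intro mult_mono) auto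
      also note h1_eq
      finally show "g2 (flow F s y) = 0" using y by (simp add: g2_def)
    qed (use h in simp)
    then have "C * (exp (- (- \<beta>) * h) * S y) \<le> C * S (flow F h y)"
      using C by (rule mult_left_mono)
    then have "u (flow F h y) \<le> exp (\<beta> * h) * u y"
      by (simp add: u_def mult.left_commute)
    also have "\<dots> \<le> (1 + \<beta> * h) * u y"
      using exp_ge_add_one_self[of "\<beta> * h"] u_le by (intro mult_right_mono_neg) auto
    finally show ?thesis by (simp add: algebra_simps)
  qed
  obtain v1 where v1: "C1 v1" "\<And>x. \<bar>v1 x - u x\<bar> \<le> e1"
    "\<And>x k d h0. 0 < h0 \<Longrightarrow>
      (\<And>y h. dist x y < \<eta> / 2 \<Longrightarrow> 0 < h \<Longrightarrow> h < h0 \<Longrightarrow> u (flow F h y) \<le> u y + h * (k * u y + d)) \<Longrightarrow>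
      grad v1 x \<bullet> F x \<le> k * v1 x + d + e1"
    by (rule smooth_approximation_within[OF u_lip \<open>0 < e1\<close> half_gt_zero[OF T2(2)]]) blast
  \<comment> \<open>The shift absorbs the smoothing error, since
    \<open>\<beta> * (e1 / \<beta>) = e1\<close>. The price is that \<open>v\<close> may become
    positive, by at most \<open>e1 + e1 / \<beta>\<close>.\<close>
  define v where "v x = v1 x + e1 / \<beta>" for x
  have v: "C1 v" "grad v = grad v1"
    unfolding v_def[abs_def] using v1(1) by (rule C1_add_const)+
  have v_le: "v x \<le> u x + e1 + e1 / \<beta>" for x
    using v1(2)[of x] by (auto simp: v_def abs_le_iff)
  have v_growth: "grad v x \<bullet> F x \<le> \<beta> * v x" if "x \<in> X" for x
  proof -
    have "grad v1 x \<bullet> F x \<le> \<beta> * v1 x + 0 + e1"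
      using h1 by (rule v1(3)) (rule u_growth[OF that])
    then show ?thesis using \<open>0 < \<beta>\<close> by (simp add: v v_def distrib_left)
  qed

  define w where "w x = max 0 (1 - J x + v x)" for x
  \<comment> \<open>Near \<open>M\<close>, \<open>J\<close> contributes \<open>2 * e1\<close> and
    \<open>v\<close> at most \<open>e1 + e1 / \<beta>\<close>; far from \<open>M\<close> the bounds
    \<open>D\<close> and \<open>- D\<close> cancel and only the share of \<open>v\<close>
    remains.\<close>
  define \<epsilon> where "\<epsilon> = 3 * e1 + e1 / \<beta>"
  have "0 \<le> e1 / \<beta>" using \<open>0 < e1\<close> \<open>0 < \<beta>\<close> by simp
  have cont_w: "continuous_on X w"
    unfolding w_def[abs_def] by (intro continuous_intros C1_continuous_on J v)
  have "grad J x \<bullet> f x + J x + v x \<le> \<epsilon>" if x: "x \<in> X" for x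
  proof (cases "\<exists>m\<in>M. dist x m < \<delta> / 2")
    case True
    then have "grad J x \<bullet> F x + J x \<le> 2 * e1" using J_near by blast
    then show ?thesis using v_le[of x] u_le[of x] F_eq[OF x] by (simp add: \<epsilon>_def)
  next
    case False
    then have "u x \<le> - D" using u_far[OF x] by force
    then show ?thesis using J_far[of x] v_le[of x] F_eq[OF x] \<open>0 < e1\<close> by (simp add: \<epsilon>_def)
  qed
  moreover have "0 \<le> J x" for x using J0_ge(2)[of x] J_ge[of x] by linarith
  moreover have "0 \<le> \<beta> * v x - grad v x \<bullet> f x" if "x \<in> X" for x
    using v_growth[OF that] F_eq[OF that] by simp
  moreover have "0 \<le> \<epsilon>" using \<open>0 < e1\<close> \<open>0 \<le> e1 / \<beta>\<close> by (simp add: \<epsilon>_def)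
  ultimately have "feasible \<beta> f X w J \<epsilon> v"
    using cont_w J(1) v(1) by (auto simp: feasible_def w_def)
  moreover have "cost X w \<epsilon> \<le> measure lebesgue V + (e1 + e1 / \<beta> + \<epsilon>) * measure lebesgue X"
  proof (rule cost_le_measure[OF compact_X cont_w V(3)])
    show "0 \<le> e1 + e1 / \<beta>" using \<open>0 < e1\<close> \<open>0 \<le> e1 / \<beta>\<close> by simp
    show "w x \<le> indicator V x + (e1 + e1 / \<beta>)" for x
    proof (cases "x \<in> V")
      case True
      then show ?thesis
        using J_ge[of x] J0_ge(2)[of x] v_le[of x] u_le[of x] \<open>0 < e1\<close> \<open>0 \<le> e1 / \<beta>\<close> by (simp add: w_def)
    next
      case False
      then show ?thesis
        using g_1 J_ge[of x] J0_ge(1)[of x] v_le[of x] u_le[of x] \<open>0 < e1\<close> \<open>0 \<le> e1 / \<beta>\<close> by (simp add: w_def)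
    qed
  qed
  moreover have "(e1 + e1 / \<beta> + \<epsilon>) * measure lebesgue X = (4 + 2 / \<beta>) * e1 * measure lebesgue X"
    by (simp add: \<epsilon>_def algebra_simps)
  ultimately show ?thesis using V(4) e1 by (intro exI[of _ w] exI[of _ J] exI[of _ \<epsilon>] exI[of _ v]) auto
qed

section \<open>Optimal value and volume gap\<close>

lemma p4_opt_eq:
  assumes A: "attracts_in f X A" and "0 < \<beta>"
  shows "p4_opt \<beta> f X = measure lebesgue A"
proof (rule antisym)
  have A_meas: "A \<in> lmeasurable"
    using A by (intro lmeasurable_compact) (simp add: attracts_in_def)
  show "p4_opt \<beta> f X \<le> measure lebesgue A"
  proof (rule field_le_epsilon)
    fix e :: real assume "0 < e"
    then obtain w J \<epsilon> v where "feasible \<beta> f X w J \<epsilon> v" "cost X w \<epsilon> \<le> measure lebesgue A + e"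
      using near_optimal_feasible[OF assms] by blast
    then show "p4_opt \<beta> f X \<le> measure lebesgue A + e"
      unfolding p4_opt_def by (blast intro: cInf_lower2[OF _ _ costs_bdd_below])
  qed
  show "measure lebesgue A \<le> p4_opt \<beta> f X"
    unfolding p4_opt_def
  proof (rule cInf_greatest[OF costs_nonempty])
    fix c assume "c \<in> {cost X w \<epsilon> | w J \<epsilon> v. feasible \<beta> f X w J \<epsilon> v}"
    then obtain w J \<epsilon> v where c: "c = cost X w \<epsilon>" and feas: "feasible \<beta> f X w J \<epsilon> v" by blast
    have "measure lebesgue A \<le> measure lebesgue (J -` {0..\<epsilon>} \<inter> v -` {0..} \<inter> X)"
      using attractor_subset_feasible[OF A feas \<open>0 < \<beta>\<close>] fmeasurableD[OF A_meas]
        lmeasurable_compact[OF compact_feasible_set[OF feas]]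
      by (rule measure_mono_fmeasurable)
    also have "\<dots> \<le> c" unfolding c using feas by (rule measure_feasible_set_le_cost)
    finally show "measure lebesgue A \<le> c" .
  qed
qed

text \<open>As \<open>A\<close> lies in the feasible set, the measure of the difference is the
  difference of the measures, and \<open>p4_opt_eq\<close> identifies the subtracted term.\<close>

lemma measure_feasible_set_Diff_le:
  assumes A: "attracts_in f X A" and feas: "feasible \<beta> f X w J \<epsilon> v" and "0 < \<beta>"
  shows "measure lebesgue (J -` {0..\<epsilon>} \<inter> v -` {0..} \<inter> X - A) \<le> cost X w \<epsilon> - p4_opt \<beta> f X"
proof -
  have A_meas: "A \<in> lmeasurable"
    using A by (intro lmeasurable_compact) (simp add: attracts_in_def)
  have "measure lebesgue (J -` {0..\<epsilon>} \<inter> v -` {0..} \<inter> X - A)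
      = measure lebesgue (J -` {0..\<epsilon>} \<inter> v -` {0..} \<inter> X) - measure lebesgue A"
    using lmeasurable_compact[OF compact_feasible_set[OF feas]] fmeasurableD[OF A_meas]
      attractor_subset_feasible[OF assms]
    by (rule measurable_measure_Diff)
  then show ?thesis
    using measure_feasible_set_le_cost[OF feas] p4_opt_eq[OF A \<open>0 < \<beta>\<close>] by simp
qed

end

theorem theorem2:
  fixes f :: "real ^ 'n \<Rightarrow> real ^ 'n" and X A :: "(real ^ 'n) set" and \<beta> :: real
  assumes "compact X"
    and "local_lipschitz (UNIV :: real set) UNIV (\<lambda>_. f)"
    and "is_global_attractor f X A"
    and "open (basin f A)"
    and "\<beta> > 0"
  defines "M \<equiv> max_pos_invariant f X"
    and "K \<equiv> (\<lambda>(J :: real ^ 'n \<Rightarrow> real) \<epsilon> (v :: real ^ 'n \<Rightarrow> real).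
                J -` {0..\<epsilon>} \<inter> v -` {0..} \<inter> X)"
  shows "p4_opt \<beta> f X = measure lebesgue A
    \<and> (\<forall>w J \<epsilon> v. feasible \<beta> f X w J \<epsilon> v \<longrightarrow>
         positively_invariant f (J -` {0..\<epsilon>} \<inter> M)
         \<and> A \<subseteq> K J \<epsilon> v
         \<and> measure lebesgue (K J \<epsilon> v - A) \<le> cost X w \<epsilon> - p4_opt \<beta> f X)
    \<and> (\<forall>w J \<epsilon> v.
         (\<forall>k::nat. feasible \<beta> f X (w k) (J k) (\<epsilon> k) (v k)) \<and>
         (\<lambda>k. cost X (w k) (\<epsilon> k)) \<longlonglongrightarrow> p4_opt \<beta> f X \<longrightarrow>
         (\<lambda>k. cost X (w k) (\<epsilon> k) - p4_opt \<beta> f X) \<longlonglongrightarrow> 0 \<and>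
         (\<lambda>k. measure lebesgue (K (J k) (\<epsilon> k) (v k) - A)) \<longlonglongrightarrow> 0)"
proof -
  have A: "attracts_in f X A" using assms(3) by (simp add: is_global_attractor_def)
  obtain F L B where F: "bounded_lipschitz_field F L B" "\<And>x. x \<in> X \<Longrightarrow> F x = f x"
    using bounded_lipschitz_extension[OF assms(1,2)] by blast
  interpret constrained_field F L B f X
    by (rule constrained_field.intro[OF F(1)]) (unfold_locales, use assms(1,2) F(2) in auto)
  have bound: "measure lebesgue (K J \<epsilon> v - A) \<le> cost X w \<epsilon> - p4_opt \<beta> f X"
    if "feasible \<beta> f X w J \<epsilon> v" for w J \<epsilon> v
    unfolding K_def using A that \<open>\<beta> > 0\<close> by (rule measure_feasible_set_Diff_le)
  show ?thesis
  proof (intro conjI allI impI)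
    show "p4_opt \<beta> f X = measure lebesgue A" using A \<open>\<beta> > 0\<close> by (rule p4_opt_eq)
  next
    fix w J \<epsilon> v assume feas: "feasible \<beta> f X w J \<epsilon> v"
    show "positively_invariant f (J -` {0..\<epsilon>} \<inter> M)"
      unfolding M_def using feas \<open>\<beta> > 0\<close> by (rule feasible_positively_invariant)
    show "A \<subseteq> K J \<epsilon> v"
      unfolding K_def using A feas \<open>\<beta> > 0\<close> by (rule attractor_subset_feasible)
    show "measure lebesgue (K J \<epsilon> v - A) \<le> cost X w \<epsilon> - p4_opt \<beta> f X"
      using feas by (rule bound)
  next
    fix w J :: "nat \<Rightarrow> real ^ 'n \<Rightarrow> real" and \<epsilon> :: "nat \<Rightarrow> real" and v :: "nat \<Rightarrow> real ^ 'n \<Rightarrow> real"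
    assume *: "(\<forall>k. feasible \<beta> f X (w k) (J k) (\<epsilon> k) (v k)) \<and>
      (\<lambda>k. cost X (w k) (\<epsilon> k)) \<longlonglongrightarrow> p4_opt \<beta> f X"
    then show lim: "(\<lambda>k. cost X (w k) (\<epsilon> k) - p4_opt \<beta> f X) \<longlonglongrightarrow> 0"
      by (simp add: LIM_zero)
    show "(\<lambda>k. measure lebesgue (K (J k) (\<epsilon> k) (v k) - A)) \<longlonglongrightarrow> 0"
      \<comment> \<open>The measures are squeezed between 0 and the excess cost.\<close>
      by (rule Lim_null_comparison[OF _ lim]) (use * bound in auto)
  qed
qed

end
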